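(* There exists a universal constant $C>0$ such that the following holds. Fix an integer $r\ge 2$ and an $r$-colouring of the edges of $K_n$ (with colours in $[r]$). For every colour $i\in[r]$, denote by $m_i$ the number of edges in colour $i$. Then, for every $i\in[r]$ and every tree $T$ on $n$ vertices with maximum degree $\Delta$, there is a copy of $T$ in $K_n$ with at least $$\frac{2m_i}{n}+C(n-1-\Delta)\left(\frac{m_i^*}{n^2}\right)^2$$ edges in colour $i$, where $m_i^*:=\min\left(m_i,\binom n2-m_i\right)$.
   Context: $[r]=\{1,\dots,r\}$. An $r$-colouring of the edges of a graph is an arbitrary map from its edge set to $[r]$. A copy of $T$ in $K_n$ is a subgraph of $K_n$ isomorphic to $T$. The constant $C$ does not depend on $r$, $n$, $T$, $\Delta$ or the colouring. *)

theory Defs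
  imports Complex_Main "HOL-Library.Ramsey"
begin

text \<open>
  Graphs are finite, simple and undirected: an edge is a 2-element set of vertices.
  The set of 2-element subsets of \<open>A\<close> is \<open>[A]\<^bsup>2\<^esup>\<close> (\<open>nsets\<close>).
\<close>

record 'a sgraph =
  verts :: "'a set"
  edges :: "'a set set"

definition simple_graph :: "'a sgraph \<Rightarrow> bool" where
  "simple_graph G \<longleftrightarrow> finite (verts G) \<and> edges G \<subseteq> [verts G]\<^bsup>2\<^esup>"

definition complete_graph :: "nat \<Rightarrow> nat sgraph" where
  "complete_graph n = \<lparr>verts = {1..n}, edges = [{1..n}]\<^bsup>2\<^esup>\<rparr>"

definition subgraph :: "'a sgraph \<Rightarrow> 'a sgraph \<Rightarrow> bool" where
  "subgraph H G \<longleftrightarrow> simple_graph H \<and> verts H \<subseteq> verts G \<and> edges H \<subseteq> edges G"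

definition isomorphic :: "'a sgraph \<Rightarrow> 'b sgraph \<Rightarrow> bool" where
  "isomorphic G H \<longleftrightarrow> (\<exists>f. bij_betw f (verts G) (verts H) \<and>
     (\<forall>u\<in>verts G. \<forall>v\<in>verts G. {u, v} \<in> edges G \<longleftrightarrow> {f u, f v} \<in> edges H))"

definition copy_in :: "'b sgraph \<Rightarrow> 'a sgraph \<Rightarrow> 'a sgraph \<Rightarrow> bool" where
  "copy_in T G H \<longleftrightarrow> subgraph H G \<and> isomorphic T H"

definition walk :: "'a sgraph \<Rightarrow> 'a list \<Rightarrow> bool" where
  "walk G p \<longleftrightarrow> p \<noteq> [] \<and> set p \<subseteq> verts G \<and> successively (\<lambda>u v. {u, v} \<in> edges G) p"

definition connected_graph :: "'a sgraph \<Rightarrow> bool" where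
  "connected_graph G \<longleftrightarrow> verts G \<noteq> {} \<and>
     (\<forall>u\<in>verts G. \<forall>v\<in>verts G. \<exists>p. walk G p \<and> hd p = u \<and> last p = v)"

text \<open>A cycle is given by the list of its distinct vertices, without repeating the first one at the end.\<close>

definition cycle :: "'a sgraph \<Rightarrow> 'a list \<Rightarrow> bool" where
  "cycle G p \<longleftrightarrow> walk G p \<and> distinct p \<and> 3 \<le> length p \<and> {last p, hd p} \<in> edges G"

definition tree :: "'a sgraph \<Rightarrow> bool" where
  "tree G \<longleftrightarrow> simple_graph G \<and> connected_graph G \<and> \<not> (\<exists>p. cycle G p)"

definition degree :: "'a sgraph \<Rightarrow> 'a \<Rightarrow> nat" where
  "degree G v = card {e \<in> edges G. v \<in> e}"

definition max_degree :: "'a sgraph \<Rightarrow> nat" where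
  "max_degree G = Max (degree G ` verts G)"

definition edge_colouring :: "nat \<Rightarrow> 'a sgraph \<Rightarrow> ('a set \<Rightarrow> nat) \<Rightarrow> bool" where
  "edge_colouring r G c \<longleftrightarrow> c \<in> edges G \<rightarrow> {1..r}"

definition colour_count :: "('a set \<Rightarrow> nat) \<Rightarrow> nat \<Rightarrow> 'a sgraph \<Rightarrow> nat" where
  "colour_count c i G = card {e \<in> edges G. c e = i}"

definition m_star :: "nat \<Rightarrow> nat \<Rightarrow> real" where
  "m_star n m = min (real m) (real (n choose 2) - real m)"

end

theory Submission
  imports Defs "HOL-Combinatorics.Permutations"
begin

text \<open>
  Let \<open>G\<close> be the set of edges of colour \<open>i\<close>, with \<open>m\<close> elements, and place \<open>T\<close> by a uniformly random
  permutation; the expected number of edges in \<open>G\<close> is \<open>2m/n\<close>. Swapping the images of two vertices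
  \<open>x, y\<close> of \<open>T\<close> whose only neighbours apart from each other are \<open>z\<close> and \<open>t\<close> respectively changes
  this number by an alternating sum over the 4-cycle on the images of \<open>x, z, y, t\<close>. A tree contains
  at least \<open>(n - 1 - \<Delta>)/24\<close> such pairs (two leaves, or two adjacent vertices of degree 2) that do not
  interfere with each other, so every swap can be performed exactly when it helps, and the
  expectation increases by \<open>(n - 1 - \<Delta>)/24\<close> times the proportion of quadruples with positive sum.

  If \<open>m*\<close> is at least \<open>4n\<close>, there are of order \<open>m*\<^sup>2 n\<^sup>4\<close> configurations of two disjoint edges and two
  disjoint non-edges of \<open>G\<close>, and each contains a quadruple with positive sum; this gives the required
  proportion. If \<open>m* < 4n\<close>, the claimed gain is below \<open>1/n\<close>, and by integrality it suffices that
  the maximum is not exactly \<open>2m/n\<close>. This holds if some sum is positive; otherwise \<open>G\<close> is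
  empty, complete, a star or the complement of a star, and in the last two cases \<open>2m\<close> is congruent
  to \<open>-2\<close> or \<open>2\<close> modulo \<open>n\<close>.
\<close>

section \<open>Swaps and permutation averages\<close>

text \<open>The arguments are images in the host: \<open>x\<close> and \<open>y\<close> are
  exchanged while \<open>z\<close> and \<open>t\<close> stay, so the pairs xz, yt are replaced by
  yz, xt. Exchanging the first two arguments negates the value.\<close>

definition swap_gain :: "'a set set \<Rightarrow> 'a \<times> 'a \<times> 'a \<times> 'a \<Rightarrow> int" where
  "swap_gain G = (\<lambda>(x, y, z, t). of_bool ({y, z} \<in> G) + of_bool ({x, t} \<in> G)
     - of_bool ({x, z} \<in> G) - of_bool ({y, t} \<in> G))"

definition quads :: "'a set \<Rightarrow> ('a \<times> 'a \<times> 'a \<times> 'a) set" where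
  "quads V = {(x, y, z, t). distinct [x, y, z, t] \<and> {x, y, z, t} \<subseteq> V}"

definition hits :: "'a set set \<Rightarrow> 'b set set \<Rightarrow> ('a \<Rightarrow> 'b) \<Rightarrow> int" where
  "hits E G p = (\<Sum>e\<in>E. of_bool (p ` e \<in> G))"

definition nbrs :: "'a set set \<Rightarrow> 'a \<Rightarrow> 'a set" where
  "nbrs E v = {u. {u, v} \<in> E}"

text \<open>Removing the other vertex from each neighbourhood covers two leaves and two adjacent
  vertices of degree 2 at once; an edge between \<open>x\<close> and \<open>y\<close> is kept by the
  swap.\<close>

definition switch :: "'a set set \<Rightarrow> 'a \<times> 'a \<times> 'a \<times> 'a \<Rightarrow> bool" where
  "switch E = (\<lambda>(x, y, z, t). distinct [x, y, z, t] \<and> nbrs E x - {y} = {z} \<and> nbrs E y - {x} = {t})"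

definition core :: "'a \<times> 'a \<times> 'a \<times> 'a \<Rightarrow> 'a set" where
  "core = (\<lambda>(x, y, z, t). {x, y})"

definition support :: "'a \<times> 'a \<times> 'a \<times> 'a \<Rightarrow> 'a set" where
  "support = (\<lambda>(x, y, z, t). {x, y, z, t})"

text \<open>A switch moves only the images of its core, while its gain depends only on the images of
  its support. Disjointness of support and foreign core thus protects all gains, yet two switches
  may still share \<open>z\<close> or \<open>t\<close>.\<close>

definition noninterfering :: "('a \<times> 'a \<times> 'a \<times> 'a) set \<Rightarrow> bool" where
  "noninterfering Q \<longleftrightarrow> (\<forall>s\<in>Q. \<forall>s'\<in>Q. s \<noteq> s' \<longrightarrow> support s \<inter> core s' = {})"

definition map4 :: "('a \<Rightarrow> 'b) \<Rightarrow> 'a \<times> 'a \<times> 'a \<times> 'a \<Rightarrow> 'b \<times> 'b \<times> 'b \<times> 'b" where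
  "map4 p = (\<lambda>(x, y, z, t). (p x, p y, p z, p t))"

lemma edge_cases:
  assumes "E \<subseteq> [V]\<^bsup>2\<^esup>" "e \<in> E"
  obtains u v where "e = {u, v}" "u \<noteq> v" "u \<in> V" "v \<in> V"
proof -
  from assms have "e \<in> [V]\<^bsup>2\<^esup>" by auto
  then obtain u v where "e = {u, v}" "u \<noteq> v" "u \<in> V" "v \<in> V"
    by (auto simp: nsets_def card_2_iff)
  then show ?thesis by (rule that)
qed

lemma finite_edges:
  assumes "finite V" "E \<subseteq> [V]\<^bsup>2\<^esup>"
  shows "finite E"
  using assms finite_subset finite_imp_finite_nsets by blast

text \<open>Only the edges xz and yt change their image under the transposition; every other edge is
  sent to itself as a set.\<close>

lemma hits_swap:
  fixes p :: "'a \<Rightarrow> 'b"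
  assumes fin: "finite V" and E: "E \<subseteq> [V]\<^bsup>2\<^esup>" and sw: "switch E (x, y, z, t)"
  shows "hits E G (p \<circ> transpose x y) = hits E G p + swap_gain G (p x, p y, p z, p t)"
proof -
  have d: "distinct [x, y, z, t]" and Nx: "nbrs E x - {y} = {z}" and Ny: "nbrs E y - {x} = {t}"
    using sw by (auto simp: switch_def)
  have "z \<in> nbrs E x" "t \<in> nbrs E y" using Nx Ny by blast+
  then have xz: "{x, z} \<in> E" and yt: "{y, t} \<in> E"
    by (simp_all add: nbrs_def insert_commute)
  have fE: "finite E" using finite_edges[OF fin E] .
  define E0 where "E0 = E - {{x, z}, {y, t}}"
  have ne: "{x, z} \<noteq> {y, t}" using d by (auto simp: doubleton_eq_iff)
  have split: "E = insert {x, z} (insert {y, t} E0)" using xz yt by (auto simp: E0_def)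
  have E0: "finite E0" "{x, z} \<notin> E0" "{y, t} \<notin> E0" using fE by (auto simp: E0_def)
  \<comment> \<open>An edge of \<open>E0\<close> that meets {x, y} can only be {x, y}
    itself.\<close>
  have inv: "transpose x y ` e = e" if e: "e \<in> E0" for e
  proof -
    have eE: "e \<in> E" using e by (simp add: E0_def)
    obtain u v where uv: "e = {u, v}" "u \<noteq> v" by (rule edge_cases[OF E eE])
    have key1: "b = y" if "{x, b} \<in> E0" for b
    proof (rule ccontr)
      assume "b \<noteq> y"
      moreover have "{b, x} \<in> E" using that by (simp add: E0_def insert_commute)
      ultimately have "b \<in> nbrs E x - {y}" by (simp add: nbrs_def)
      then show False using that Nx by (simp add: E0_def)
    qed
    have key2: "b = x" if "{y, b} \<in> E0" for b
    proof (rule ccontr)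
      assume "b \<noteq> x"
      moreover have "{b, y} \<in> E" using that by (simp add: E0_def insert_commute)
      ultimately have "b \<in> nbrs E y - {x}" by (simp add: nbrs_def)
      then show False using that Ny by (simp add: E0_def)
    qed
    have c: "{u, v} \<in> E0" "{v, u} \<in> E0" using e uv by (auto simp: insert_commute)
    show ?thesis
    proof (cases "u \<in> {x, y} \<or> v \<in> {x, y}")
      case True
      then consider "u = x" | "u = y" | "v = x" | "v = y" by blast
      then have "e = {x, y}"
      proof cases
        case 1
        then show ?thesis using key1[of v] c uv by simp
      next
        case 2
        then show ?thesis using key2[of v] c uv by (simp add: insert_commute)
      next
        case 3
        then show ?thesis using key1[of u] c uv by (simp add: insert_commute)
      next
        case 4
        then show ?thesis using key2[of u] c uv by simp
      qed
      then show ?thesis by auto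
    next
      case False
      then show ?thesis using uv by (simp add: transpose_def)
    qed
  qed
  have tr: "transpose x y z = z" "transpose x y t = t" using d by auto
  have rest: "(\<Sum>e\<in>E0. of_bool ((p \<circ> transpose x y) ` e \<in> G)) = (\<Sum>e\<in>E0. of_bool (p ` e \<in> G) :: int)"
    using inv by (intro sum.cong refl) (simp only: image_comp [symmetric])
  have "hits E G (p \<circ> transpose x y)
      = of_bool ((p \<circ> transpose x y) ` {x, z} \<in> G) + of_bool ((p \<circ> transpose x y) ` {y, t} \<in> G)
        + (\<Sum>e\<in>E0. of_bool (p ` e \<in> G))"
    unfolding hits_def split using E0 ne rest by (simp del: image_insert)
  also have "\<dots> = of_bool ({p y, p z} \<in> G) + of_bool ({p x, p t} \<in> G) + (\<Sum>e\<in>E0. of_bool (p ` e \<in> G))"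
    using tr by simp
  also have "\<dots> = hits E G p + swap_gain G (p x, p y, p z, p t)"
    unfolding hits_def swap_gain_def split using E0 ne by simp
  finally show ?thesis .
qed

text \<open>Non-interference makes the gains of the individual switches additive, so each one can be
  applied or not according to the sign of its own gain.\<close>

lemma switches_gain:
  assumes fin: "finite V" and E: "E \<subseteq> [V]\<^bsup>2\<^esup>" and Q: "finite Q" "\<And>s. s \<in> Q \<Longrightarrow> switch E s"
    "noninterfering Q" "\<And>s. s \<in> Q \<Longrightarrow> support s \<subseteq> V" and p: "p permutes V"
  shows "\<exists>p'. p' permutes V \<and> (\<forall>v. v \<notin> \<Union> (core ` Q) \<longrightarrow> p' v = p v)
    \<and> hits E G p' \<ge> hits E G p + (\<Sum>s\<in>Q. max 0 (swap_gain G (map4 p s)))"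
  using Q
proof (induction Q rule: finite_induct)
  case empty
  then show ?case using p by auto
next
  case (insert s Q)
  have "noninterfering Q" using insert.prems(2) by (simp add: noninterfering_def)
  then obtain p' where p': "p' permutes V" "\<And>v. v \<notin> \<Union> (core ` Q) \<Longrightarrow> p' v = p v"
    "hits E G p' \<ge> hits E G p + (\<Sum>s\<in>Q. max 0 (swap_gain G (map4 p s)))"
    using insert.IH insert.prems by (metis insert_iff)
  obtain x y z t where s: "s = (x, y, z, t)" by (cases s) auto
  have sw: "switch E (x, y, z, t)" using insert.prems(1)[of s] s by simp
  have sV: "{x, y, z, t} \<subseteq> V" using insert.prems(3)[of s] s by (simp add: support_def)
  have disj: "support s \<inter> \<Union> (core ` Q) = {}"
    using insert.prems(2) insert.hyps(2) by (fastforce simp: noninterfering_def)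
  \<comment> \<open>The earlier switches moved nothing in the support of \<open>s\<close>, so the
    gain of \<open>s\<close> is still the one computed from the original \<open>p\<close>.\<close>
  have same: "p' v = p v" if "v \<in> {x, y, z, t}" for v
    using p'(2) disj that s by (auto simp: support_def)
  have m: "map4 p s = (p' x, p' y, p' z, p' t)" using same s by (simp add: map4_def)
  show ?case
  proof (cases "swap_gain G (map4 p s) \<ge> 0")
    case True
    let ?q = "p' \<circ> transpose x y"
    have "?q permutes V"
      using permutes_compose[OF permutes_swap_id p'(1)] sV by simp
    moreover have "?q v = p v" if "v \<notin> \<Union> (core ` insert s Q)" for v
      using that p'(2)[of v] s by (auto simp: core_def transpose_def)
    moreover have "hits E G ?q \<ge> hits E G p + (\<Sum>s\<in>insert s Q. max 0 (swap_gain G (map4 p s)))"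
      using hits_swap[OF fin E sw, of G p'] p'(3) insert.hyps True m by simp
    ultimately show ?thesis by blast
  next
    case False
    then show ?thesis using p' insert.hyps by (intro exI[of _ p']) auto
  qed
qed

section \<open>Averages over all permutations of a finite set\<close>

text \<open>The complements of \<open>A\<close> and \<open>B\<close> have equal size, so any
  bijection between them completes \<open>f\<close>. This supplies transitivity on pairs and on
  quadruples.\<close>

lemma permutes_extend:
  assumes "finite V" "A \<subseteq> V" "B \<subseteq> V" "bij_betw f A B"
  obtains \<pi> where "\<pi> permutes V" "\<And>a. a \<in> A \<Longrightarrow> \<pi> a = f a"
proof -
  have "card (V - A) = card (V - B)"
    using assms bij_betw_same_card[OF assms(4)] by (simp add: card_Diff_subset finite_subset)
  then obtain g where g: "bij_betw g (V - A) (V - B)"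
    using assms(1) by (meson finite_Diff finite_same_card_bij)
  let ?h = "\<lambda>v. if v \<in> A then f v else if v \<in> V then g v else v"
  have 1: "bij_betw ?h A B" using assms(4) by (rule bij_betw_cong[THEN iffD1, rotated]) auto
  have 2: "bij_betw ?h (V - A) (V - B)" using g by (rule bij_betw_cong[THEN iffD1, rotated]) auto
  have "bij_betw ?h (A \<union> (V - A)) (B \<union> (V - B))" using bij_betw_combine[OF 1 2] by auto
  then have "bij_betw ?h V V" using assms by (simp add: Un_absorb1)
  then have "?h permutes V" by (rule bij_imp_permutes) (use assms in auto)
  then show ?thesis by (rule that) simp
qed

text \<open>Averaging over a transitive action: the left sum does not depend on the base point, so
  it may be summed over all base points, and after exchanging the sums each permutation merely
  rearranges \<open>X\<close>. Multiplying out the denominators allows any commutative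
  semiring.\<close>

lemma sum_permutes_orbit:
  fixes F :: "'b \<Rightarrow> 'c::comm_semiring_1"
  assumes fin: "finite V" "finite X"
    and act: "\<And>p a. p permutes V \<Longrightarrow> a \<in> X \<Longrightarrow> f p a \<in> X"
    and inj: "\<And>p. p permutes V \<Longrightarrow> inj_on (f p) X"
    and comp: "\<And>p q a. p permutes V \<Longrightarrow> q permutes V \<Longrightarrow> f (p \<circ> q) a = f p (f q a)"
    and trans: "\<And>a a'. a \<in> X \<Longrightarrow> a' \<in> X \<Longrightarrow> \<exists>q. q permutes V \<and> f q a = a'"
    and o1: "o1 \<in> X"
  shows "of_nat (card X) * (\<Sum>p | p permutes V. F (f p o1)) = of_nat (fact (card V)) * (\<Sum>a\<in>X. F a)"
proof -
  have eq: "(\<Sum>p | p permutes V. F (f p o2)) = (\<Sum>p | p permutes V. F (f p o1))" if o2: "o2 \<in> X" for o2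
  proof -
    obtain q where q: "q permutes V" "f q o1 = o2" using trans[OF o1 o2] by blast
    \<comment> \<open>Right multiplication by \<open>q\<close> permutes the summation range and
      moves the base point from \<open>o1\<close> to \<open>o2\<close>.\<close>
    have "(\<Sum>p | p permutes V. F (f p o1)) = (\<Sum>p | p permutes V. F (f (p \<circ> q) o1))"
      using sum_permutations_compose_right[OF q(1)] by simp
    also have "\<dots> = (\<Sum>p | p permutes V. F (f p o2))"
      using comp q by (intro sum.cong) auto
    finally show ?thesis by simp
  qed
  have "of_nat (card X) * (\<Sum>p | p permutes V. F (f p o1)) = (\<Sum>o2\<in>X. \<Sum>p | p permutes V. F (f p o2))"
    using eq by simp
  also have "\<dots> = (\<Sum>p | p permutes V. \<Sum>a\<in>X. F (f p a))" by (rule sum.swap)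
  also have "\<dots> = (\<Sum>p | p permutes V. \<Sum>a\<in>X. F a)"
  proof (rule sum.cong[OF refl])
    fix p assume "p \<in> {p. p permutes V}"
    then have "bij_betw (f p) X X"
      using inj act fin(2) by (auto simp: bij_betw_def endo_inj_surj image_subsetI)
    then show "(\<Sum>a\<in>X. F (f p a)) = (\<Sum>a\<in>X. F a)" by (rule sum.reindex_bij_betw)
  qed
  also have "\<dots> = of_nat (fact (card V)) * (\<Sum>a\<in>X. F a)"
    using card_permutations[OF refl fin(1)] by simp
  finally show ?thesis .
qed

lemma sum_permutes_edge:
  fixes F :: "'a set \<Rightarrow> 'c::comm_semiring_1"
  assumes fin: "finite V" and e: "e \<in> [V]\<^bsup>2\<^esup>"
  shows "of_nat (card V choose 2) * (\<Sum>p | p permutes V. F (p ` e))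
    = of_nat (fact (card V)) * (\<Sum>e\<in>[V]\<^bsup>2\<^esup>. F e)"
proof -
  have "of_nat (card ([V]\<^bsup>2\<^esup>)) * (\<Sum>p | p permutes V. F (p ` e))
    = of_nat (fact (card V)) * (\<Sum>e\<in>[V]\<^bsup>2\<^esup>. F e)"
  proof (rule sum_permutes_orbit[where f = "image"])
    show "finite ([V]\<^bsup>2\<^esup>)" using fin by (rule finite_imp_finite_nsets)
  next
    fix p a assume p: "p permutes V" and a: "a \<in> [V]\<^bsup>2\<^esup>"
    show "p ` a \<in> [V]\<^bsup>2\<^esup>"
      using p a permutes_in_image[OF p] inj_on_subset[OF permutes_inj_on[OF p]]
      by (auto simp: nsets_def card_image)
  next
    fix p assume p: "p permutes V"
    then show "inj_on ((`) p) ([V]\<^bsup>2\<^esup>)"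
      by (meson inj_image_eq_iff inj_onI permutes_inj)
  next
    fix a a' assume a: "a \<in> [V]\<^bsup>2\<^esup>" "a' \<in> [V]\<^bsup>2\<^esup>"
    then have "finite a" "finite a'" "card a = card a'" by (auto simp: nsets_def)
    then obtain g where g: "bij_betw g a a'" by (metis finite_same_card_bij)
    obtain q where "q permutes V" "\<And>v. v \<in> a \<Longrightarrow> q v = g v"
      using permutes_extend[OF fin _ _ g] a by (auto simp: nsets_def)
    then show "\<exists>q. q permutes V \<and> q ` a = a'"
      using g by (metis bij_betw_imp_surj_on image_cong)
  qed (use fin e in \<open>auto simp: image_comp\<close>)
  then show ?thesis by (simp add: card_nsets)
qed

lemma finite_quads: "finite V \<Longrightarrow> finite (quads V)"
  by (rule finite_subset[of _ "V \<times> V \<times> V \<times> V"]) (auto simp: quads_def)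

lemma sum_permutes_quad:
  fixes F :: "'a \<times> 'a \<times> 'a \<times> 'a \<Rightarrow> 'c::comm_semiring_1"
  assumes fin: "finite V" and s: "s \<in> quads V"
  shows "of_nat (card (quads V)) * (\<Sum>p | p permutes V. F (map4 p s))
    = of_nat (fact (card V)) * (\<Sum>s\<in>quads V. F s)"
proof (rule sum_permutes_orbit[where f = map4])
  fix p a assume p: "p permutes V" and a: "a \<in> quads V"
  show "map4 p a \<in> quads V"
    using p a permutes_in_image[OF p] inj_eq[OF permutes_inj[OF p]]
    by (auto simp: quads_def map4_def)
next
  fix p assume p: "p permutes V"
  then show "inj_on (map4 p) (quads V)"
    by (auto simp: inj_on_def map4_def dest: inj_eq[OF permutes_inj[OF p], THEN iffD1])
next
  fix a a' assume a: "a \<in> quads V" "a' \<in> quads V"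
  obtain x y z t where o1: "a = (x, y, z, t)" by (cases a) auto
  obtain x' y' z' t' where o2: "a' = (x', y', z', t')" by (cases a') auto
  let ?g = "\<lambda>v. if v = x then x' else if v = y then y' else if v = z then z' else t'"
  have g: "bij_betw ?g {x, y, z, t} {x', y', z', t'}"
    using a o1 o2 by (auto simp: bij_betw_def inj_on_def quads_def)
  obtain q where "q permutes V" "\<And>a. a \<in> {x, y, z, t} \<Longrightarrow> q a = ?g a"
    by (rule permutes_extend[OF fin _ _ g]) (use a o1 o2 in \<open>auto simp: quads_def\<close>)
  then show "\<exists>q. q permutes V \<and> map4 q a = a'"
    using a o1 o2 by (intro exI[of _ q]) (auto simp: map4_def quads_def)
next
  fix p q :: "'a \<Rightarrow> 'a" and a
  show "map4 (p \<circ> q) a = map4 p (map4 q a)" by (simp add: map4_def split: prod.splits)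
next
  show "finite V" "finite (quads V)" "s \<in> quads V" using assms finite_quads by auto
qed

section \<open>Noninterfering switches in a tree\<close>

lemma core_subset_support: "core s \<subseteq> support s"
  by (cases s) (auto simp: core_def support_def)

section \<open>Degrees and edge counts in connected and in acyclic graphs\<close>

lemma edge_ends:
  assumes E: "E \<subseteq> [V]\<^bsup>2\<^esup>" and e: "{u, v} \<in> E"
  shows "u \<in> V" "v \<in> V" "u \<noteq> v"
  using subsetD[OF E e] by simp_all

lemma card_incident:
  assumes E: "E \<subseteq> [V]\<^bsup>2\<^esup>"
  shows "card {e \<in> E. v \<in> e} = card (nbrs E v)"
proof -
  have "{e \<in> E. v \<in> e} = (\<lambda>u. {u, v}) ` nbrs E v"
  proof (intro equalityI subsetI)
    fix e assume e: "e \<in> {e \<in> E. v \<in> e}"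
    then have eE: "e \<in> E" by simp
    obtain a b where ab: "e = {a, b}" by (rule edge_cases[OF E eE])
    then show "e \<in> (\<lambda>u. {u, v}) ` nbrs E v"
      using e by (auto simp: nbrs_def insert_commute)
  qed (auto simp: nbrs_def)
  moreover have "inj_on (\<lambda>u. {u, v}) (nbrs E v)"
    by (auto simp: inj_on_def doubleton_eq_iff)
  ultimately show ?thesis by (simp add: card_image)
qed

lemma nbrs_sym: "u \<in> nbrs E v \<longleftrightarrow> v \<in> nbrs E u"
  by (simp add: nbrs_def insert_commute)

lemma nbrs_subset:
  assumes E: "E \<subseteq> [V]\<^bsup>2\<^esup>"
  shows "nbrs E v \<subseteq> V - {v}"
proof
  fix u assume "u \<in> nbrs E v"
  then show "u \<in> V - {v}" using edge_ends[OF E, of u v] by (simp add: nbrs_def)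
qed

lemma nbrs_pair: "{u, v} \<in> E \<Longrightarrow> u \<in> nbrs E v \<and> v \<in> nbrs E u"
  by (simp add: nbrs_def insert_commute)

lemma sum_card_nbrs:
  assumes V: "finite V" and E: "E \<subseteq> [V]\<^bsup>2\<^esup>"
  shows "(\<Sum>v\<in>V. card (nbrs E v)) = 2 * card E"
proof -
  have "card {v \<in> V. v \<in> e} = 2" if "e \<in> E" for e
  proof -
    have "e \<in> [V]\<^bsup>2\<^esup>" using E that by auto
    then have "{v \<in> V. v \<in> e} = e" "card e = 2" by (auto simp: nsets_def)
    then show ?thesis by simp
  qed
  then have "(\<Sum>v\<in>V. card {e \<in> E. v \<in> e}) = 2 * card E"
    using V finite_edges[OF V E] by (intro sum_multicount) auto
  then show ?thesis using card_incident[OF E] by simp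
qed

lemma successively_last_in:
  assumes "successively R p" "p \<noteq> []" "hd p \<in> S" "\<And>u v. R u v \<Longrightarrow> u \<in> S \<Longrightarrow> v \<in> S"
  shows "last p \<in> S"
  using assms by (induction p rule: induct_list012) auto

text \<open>Membership in \<open>S\<close> propagates along a walk from \<open>r\<close>.
  Connectivity enters the counting arguments below in this form.\<close>

lemma connected_closed:
  assumes G: "connected_graph G" and r: "r \<in> verts G" "r \<in> S"
    and closed: "\<And>u v. {u, v} \<in> edges G \<Longrightarrow> u \<in> S \<Longrightarrow> v \<in> S"
  shows "verts G \<subseteq> S"
proof
  fix v assume "v \<in> verts G"
  then obtain p where p: "walk G p" "hd p = r" "last p = v"
    using G r unfolding connected_graph_def by blast
  then show "v \<in> S"
    using successively_last_in[of "\<lambda>u v. {u, v} \<in> edges G" p S] r closed unfolding walk_def by blast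
qed

text \<open>A largest vertex set spanning at least its size minus one edges must be everything:
  otherwise connectivity gives an edge leaving it, and adding the outer end adds at least one
  spanned edge.\<close>

lemma connected_card_edges:
  assumes G: "simple_graph G" and conn: "connected_graph G"
  shows "card (verts G) \<le> card (edges G) + 1"
proof -
  define P where "P S \<longleftrightarrow> S \<noteq> {} \<and> S \<subseteq> verts G \<and> card S \<le> card {e \<in> edges G. e \<subseteq> S} + 1" for S
  have V: "finite (verts G)" and E: "edges G \<subseteq> [verts G]\<^bsup>2\<^esup>" using G by (auto simp: simple_graph_def)
  have fE: "finite (edges G)" using finite_edges[OF V E] .
  obtain r where r: "r \<in> verts G" using conn by (auto simp: connected_graph_def)
  have "P {r}" using r by (simp add: P_def)
  moreover have "\<forall>S. P S \<longrightarrow> card S < card (verts G) + 1" using V by (auto simp: P_def less_Suc_eq_le intro: card_mono)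
  ultimately obtain S where S: "P S" and max: "\<And>S'. P S' \<Longrightarrow> card S' \<le> card S"
    using ex_has_greatest_nat[of P "{r}" card "card (verts G) + 1"] by blast
  have fS: "finite S" using S V finite_subset unfolding P_def by blast
  have "verts G \<subseteq> S"
  proof (rule ccontr)
    assume "\<not> verts G \<subseteq> S"
    moreover obtain s where "s \<in> S" "s \<in> verts G" using S unfolding P_def by blast
    ultimately obtain u v where uv: "{u, v} \<in> edges G" "u \<in> S" "v \<notin> S"
      using connected_closed[OF conn] by blast
    have v: "v \<in> verts G" using edge_ends[OF E uv(1)] by simp
    have "{u, v} \<notin> {e \<in> edges G. e \<subseteq> S}" using uv by simp
    then have "card {e \<in> edges G. e \<subseteq> S} + 1 = card (insert {u, v} {e \<in> edges G. e \<subseteq> S})"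
      using fE by simp
    also have "\<dots> \<le> card {e \<in> edges G. e \<subseteq> insert v S}"
      using fE uv by (intro card_mono) auto
    finally have "P (insert v S)" using S uv v fS by (auto simp: P_def)
    then show False using max[of "insert v S"] uv fS by simp
  qed
  then have "card (verts G) \<le> card S" using fS by (rule card_mono[rotated])
  also have "\<dots> \<le> card {e \<in> edges G. e \<subseteq> S} + 1" using S by (simp add: P_def)
  also have "\<dots> \<le> card (edges G) + 1" using fE by (simp add: card_mono)
  finally show ?thesis .
qed

text \<open>All neighbours of an end of a longest path lie on that path, so two of them give a cycle.\<close>

lemma acyclic_low_degree:
  assumes G: "simple_graph G" and ac: "\<nexists>p. cycle G p" and ne: "verts G \<noteq> {}"
  shows "\<exists>v\<in>verts G. card (nbrs (edges G) v) \<le> 1"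
proof (rule ccontr)
  assume "\<not> ?thesis"
  then have deg: "card (nbrs (edges G) v) \<ge> 2" if "v \<in> verts G" for v using that by force
  have V: "finite (verts G)" and E: "edges G \<subseteq> [verts G]\<^bsup>2\<^esup>" using G by (auto simp: simple_graph_def)
  let ?P = "\<lambda>p. walk G p \<and> distinct p"
  obtain r where r: "r \<in> verts G" using ne by blast
  have "?P [r]" using r by (simp add: walk_def)
  moreover have "length p < card (verts G) + 1" if "?P p" for p
    using that V card_mono[of "verts G" "set p"] by (simp add: walk_def distinct_card)
  ultimately obtain p where p: "?P p" and max: "\<And>q. ?P q \<Longrightarrow> length q \<le> length p"
    using ex_has_greatest_nat[of ?P "[r]" length "card (verts G) + 1"] by blast
  obtain v p' where vp: "p = v # p'" using p by (cases p) (auto simp: walk_def)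
  have v: "v \<in> verts G" using p vp by (simp add: walk_def)
  have on: "u \<in> set p'" if u: "u \<in> nbrs (edges G) v" for u
  proof (rule ccontr)
    assume "u \<notin> set p'"
    moreover have "u \<in> verts G" "u \<noteq> v" using nbrs_subset[OF E, of v] u by auto
    moreover have "{u, v} \<in> edges G" using u by (simp add: nbrs_def)
    ultimately have "?P (u # p)" using p vp by (auto simp: walk_def)
    then show False using max[of "u # p"] by simp
  qed
  obtain w p'' where wp: "p' = w # p''"
    using deg[OF v] on by (cases p') (auto, fastforce)
  have "\<exists>u\<in>nbrs (edges G) v. u \<noteq> w"
  proof (rule ccontr)
    assume "\<not> ?thesis"
    then have "nbrs (edges G) v \<subseteq> {w}" by auto
    then have "card (nbrs (edges G) v) \<le> card {w}" by (intro card_mono) auto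
    then show False using deg[OF v] by simp
  qed
  then obtain u where u: "u \<in> nbrs (edges G) v" "u \<noteq> w" by blast
  then have "u \<in> set p''" using on wp by auto
  then obtain xs ys where xs: "p'' = xs @ u # ys" by (meson split_list)
  have pe: "p = (v # w # xs @ [u]) @ ys" using vp wp xs by simp
  have "cycle G (v # w # xs @ [u])"
    using p u unfolding cycle_def walk_def pe successively_append_iff
    by (auto simp: nbrs_def)
  then show False using ac by blast
qed

text \<open>Deleting a vertex of degree at most 1 keeps the graph acyclic and loses at most one
  edge. A single vertex is treated apart because the remainder must be nonempty.\<close>

lemma acyclic_card_edges:
  assumes "simple_graph G" "\<nexists>p. cycle G p" "verts G \<noteq> {}"
  shows "card (edges G) + 1 \<le> card (verts G)"
  using assms
proof (induction "card (verts G)" arbitrary: G rule: less_induct)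
  case less
  have V: "finite (verts G)" and E: "edges G \<subseteq> [verts G]\<^bsup>2\<^esup>"
    using less.prems(1) by (auto simp: simple_graph_def)
  have fE: "finite (edges G)" using finite_edges[OF V E] .
  obtain v where v: "v \<in> verts G" "card (nbrs (edges G) v) \<le> 1"
    using acyclic_low_degree[OF less.prems] by blast
  let ?H = "\<lparr>verts = verts G - {v}, edges = {e \<in> edges G. v \<notin> e}\<rparr>"
  show ?case
  proof (cases "verts G = {v}")
    case True
    then have "edges G = {}" using E by (simp add: nsets_2_eq)
    then show ?thesis using True by simp
  next
    case False
    have H: "simple_graph ?H" using V E by (auto simp: simple_graph_def nsets_def)
    moreover have "\<nexists>p. cycle ?H p"
    proof
      assume "\<exists>p. cycle ?H p"
      then obtain p where "cycle ?H p" by blast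
      then have "cycle G p"
        by (auto simp: cycle_def walk_def elim: successively_mono)
      then show False using less.prems(2) by blast
    qed
    moreover have "card (verts ?H) < card (verts G)" using card_Diff1_less[OF V v(1)] by simp
    ultimately have "card (edges ?H) + 1 \<le> card (verts ?H)"
      using less.hyps[of ?H] False v by auto
    moreover have "card (edges G) \<le> card (edges ?H) + 1"
    proof -
      have "edges G = {e \<in> edges G. v \<notin> e} \<union> {e \<in> edges G. v \<in> e}" by auto
      then have "card (edges G) \<le> card {e \<in> edges G. v \<notin> e} + card {e \<in> edges G. v \<in> e}"
        by (metis card_Un_le)
      then show ?thesis using v(2) card_incident[OF E, of v] by simp
    qed
    moreover have "card (verts ?H) + 1 = card (verts G)"
      using card.remove[OF V v(1)] by simp
    ultimately show ?thesis by linarith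
  qed
qed

lemma tree_card_edges:
  assumes "tree G"
  shows "card (edges G) + 1 = card (verts G)"
  using assms connected_card_edges[of G] acyclic_card_edges[of G]
  by (auto simp: tree_def connected_graph_def intro!: le_antisym)

lemma connected_nbrs_pos:
  assumes G: "simple_graph G" "connected_graph G" and n: "card (verts G) \<ge> 2" and v: "v \<in> verts G"
  shows "card (nbrs (edges G) v) \<ge> 1"
proof (rule ccontr)
  assume "\<not> ?thesis"
  moreover have "finite (nbrs (edges G) v)"
    using G(1) nbrs_subset[of "edges G" "verts G" v] by (auto simp: simple_graph_def intro: finite_subset)
  ultimately have "nbrs (edges G) v = {}" by (simp add: not_less_eq_eq)
  then have "verts G \<subseteq> {v}"
    using connected_closed[OF G(2) v, of "{v}"] by (auto simp: nbrs_def insert_commute)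
  then have "card (verts G) \<le> card {v}" by (intro card_mono) auto
  then show False using n by simp
qed

section \<open>Large noninterfering families of switches in a tree\<close>

lemma tree_triangle_free:
  assumes "tree G" "{a, b} \<in> edges G" "{b, c} \<in> edges G" "{c, a} \<in> edges G"
  shows False
proof -
  have E: "edges G \<subseteq> [verts G]\<^bsup>2\<^esup>" using assms(1) by (simp add: tree_def simple_graph_def)
  have "cycle G [a, b, c]"
    using assms(2-4) edge_ends[OF E assms(2)] edge_ends[OF E assms(3)] edge_ends[OF E assms(4)]
    by (auto simp: cycle_def walk_def)
  then show False using assms(1) by (auto simp: tree_def)
qed

text \<open>A maximal noninterfering family of switches has a support meeting every pair of leaves with
  different neighbours and every edge between two vertices of degree 2. Outside that support all
  leaves therefore hang on a single vertex \<open>u\<close>, and the remaining edges avoiding \<open>u\<close> are counted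
  through their end vertices of degree at least 3.\<close>

lemma tree_switches:
  assumes T: "tree T"
  shows "\<exists>Q. (\<forall>s\<in>Q. switch (edges T) s) \<and> Q \<subseteq> quads (verts T) \<and> noninterfering Q
    \<and> card (verts T) \<le> 1 + max_degree T + 24 * card Q"
proof -
  define V E where "V = verts T" and "E = edges T"
  have G: "simple_graph T" "connected_graph T" using T by (auto simp: tree_def)
  have V: "finite V" and E: "E \<subseteq> [V]\<^bsup>2\<^esup>" using G(1) by (auto simp: simple_graph_def V_def E_def)
  define d where "d v = card (nbrs E v)" for v
  have fE: "finite E" using finite_edges[OF V E] .
  have fN: "finite (nbrs E v)" for v using nbrs_subset[OF E, of v] V finite_subset by blast
  have Vne: "V \<noteq> {}" using G(2) by (simp add: connected_graph_def V_def)
  have dmax: "d v \<le> max_degree T" if "v \<in> V" for v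
  proof -
    have "d v = degree T v" using card_incident[OF E, of v] by (simp add: d_def degree_def E_def)
    then show ?thesis using that V unfolding max_degree_def V_def by (auto intro: Max_ge)
  qed
  have dpos: "d v \<ge> 1" if "v \<in> V" "card V \<ge> 2" for v
    using connected_nbrs_pos[OF G] that by (simp add: d_def V_def E_def)
  show ?thesis
  \<comment> \<open>For at most two vertices the empty family suffices; a third vertex excludes two
    leaves that are adjacent to each other.\<close>
  proof (cases "card V \<ge> 3")
    case False
    obtain v where "v \<in> V" using Vne by blast
    then have "card V \<le> 1 + max_degree T"
      using dmax[of v] dpos[of v] False by (cases "card V \<ge> 2") auto
    then show ?thesis by (intro exI[of _ "{}"]) (simp add: noninterfering_def V_def)
  next
    case n3: True
    define P where "P Q \<longleftrightarrow> (\<forall>s\<in>Q. switch E s) \<and> Q \<subseteq> quads V \<and> noninterfering Q" for Q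
    have "P {}" by (simp add: P_def noninterfering_def)
    moreover have "\<forall>Q. P Q \<longrightarrow> card Q < card (quads V) + 1"
      using finite_quads[OF V] by (auto simp: P_def less_Suc_eq_le intro: card_mono)
    ultimately obtain Q where Q: "P Q" and max: "\<And>Q'. P Q' \<Longrightarrow> card Q' \<le> card Q"
      using ex_has_greatest_nat[of P "{}" card "card (quads V) + 1"] by blast
    have fQ: "finite Q" using Q finite_quads[OF V] finite_subset unfolding P_def by blast
    define W where "W = \<Union> (support ` Q)"
    have fW: "finite W" using fQ by (auto simp: W_def support_def split: prod.splits)
    have "card W \<le> (\<Sum>s\<in>Q. card (support s))" unfolding W_def using fQ by (rule card_UN_le)
    also have "\<dots> \<le> (\<Sum>s\<in>Q. 4)"
    proof (rule sum_mono)
      fix s :: "'a \<times> 'a \<times> 'a \<times> 'a"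
      obtain x y z t where "s = (x, y, z, t)" by (cases s) auto
      then show "card (support s) \<le> 4"
        using card_length[of "[x, y, z, t]"] by (simp add: support_def)
    qed
    finally have cW: "card W \<le> 4 * card Q" by simp

    \<comment> \<open>Otherwise the switch could be added to the maximal family. Its
      \<open>z\<close> and \<open>t\<close> may lie in \<open>W\<close>, but not in a core: all
      neighbours of a core vertex lie in the same support, which would put \<open>x\<close> or
      \<open>y\<close> into \<open>W\<close>.\<close>
    have blocked: "x \<in> W \<or> y \<in> W" if s: "(x, y, z, t) \<in> quads V" "switch E (x, y, z, t)" for x y z t
    proof (rule ccontr)
      assume nW: "\<not> (x \<in> W \<or> y \<in> W)"
      let ?s = "(x, y, z, t)"
      have core_nbr: "v \<in> W" if s': "s' \<in> Q" and c: "w \<in> core s'" "w \<in> nbrs E v" for s' v w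
      proof -
        obtain x' y' z' t' where s'e: "s' = (x', y', z', t')" by (cases s') auto
        have "switch E (x', y', z', t')" using Q s' s'e by (auto simp: P_def)
        then have "nbrs E x' \<subseteq> {y', z'}" "nbrs E y' \<subseteq> {x', t'}" by (auto simp: switch_def)
        moreover have "v \<in> nbrs E w" using c(2) nbrs_sym by fast
        ultimately have "v \<in> support s'" using c(1) s'e by (auto simp: core_def support_def)
        then show ?thesis using s' by (auto simp: W_def)
      qed
      have z: "z \<in> nbrs E x" "t \<in> nbrs E y" using s(2) by (auto simp: switch_def)
      have "?s \<notin> Q" using nW by (force simp: W_def support_def)
      have "P (insert ?s Q)"
      proof -
        have 1: "support s' \<inter> core ?s = {}" if "s' \<in> Q" for s'
          using nW that by (auto simp: W_def core_def)
        have 2: "support ?s \<inter> core s' = {}" if "s' \<in> Q" for s'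
        proof -
          have "core s' \<subseteq> W" using that core_subset_support[of s'] by (auto simp: W_def)
          moreover have "z \<notin> core s'" using core_nbr[OF that, of z x] z nW by blast
          moreover have "t \<notin> core s'" using core_nbr[OF that, of t y] z nW by blast
          ultimately show ?thesis using nW by (auto simp: support_def)
        qed
        have "noninterfering (insert ?s Q)"
          using Q 1 2 unfolding noninterfering_def P_def by blast
        then show ?thesis using Q s by (simp add: P_def)
      qed
      then show False using max[of "insert ?s Q"] fQ \<open>?s \<notin> Q\<close> by simp
    qed

    have leaves: "v1 \<in> W \<or> v2 \<in> W"
      if v: "v1 \<in> V" "v2 \<in> V" and N: "nbrs E v1 = {p1}" "nbrs E v2 = {p2}" and ne: "v1 \<noteq> v2" "p1 \<noteq> p2"
      for v1 v2 p1 p2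
    proof -
      have "v2 \<notin> nbrs E v1"
      proof
        assume v2: "v2 \<in> nbrs E v1"
        then have "v1 \<in> nbrs E v2" using nbrs_sym by fast
        then have p: "p1 = v2" "p2 = v1" using v2 N by auto
        have "verts T \<subseteq> {v1, v2}"
        proof (rule connected_closed[OF G(2), of v1])
          fix a b assume "{a, b} \<in> edges T" "a \<in> {v1, v2}"
          then show "b \<in> {v1, v2}" using nbrs_pair[of a b E] N p unfolding E_def by blast
        qed (use v V_def in auto)
        then have "card V \<le> card {v1, v2}" unfolding V_def by (intro card_mono) auto
        then show False using n3 ne by simp
      qed
      moreover have "v1 \<notin> nbrs E v2" using calculation nbrs_sym by fast
      moreover have "p1 \<in> V - {v1}" "p2 \<in> V - {v2}" using nbrs_subset[OF E] N by blast+
      ultimately show ?thesis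
        using v N ne by (intro blocked[of v1 v2 p1 p2]) (auto simp: quads_def switch_def)
    qed
    have paths: "x \<in> W \<or> y \<in> W" if xy: "{x, y} \<in> E" "d x = 2" "d y = 2" for x y
    proof -
      have n: "y \<in> nbrs E x" "x \<in> nbrs E y" using nbrs_pair[OF xy(1)] by auto
      have "card (nbrs E x - {y}) = 1" "card (nbrs E y - {x}) = 1"
        using n xy fN by (simp_all add: d_def)
      then obtain z t where zt: "nbrs E x - {y} = {z}" "nbrs E y - {x} = {t}"
        by (auto simp: card_1_singleton_iff)
      have e: "{z, x} \<in> E" "{t, y} \<in> E" using zt by (auto simp: nbrs_def)
      \<comment> \<open>A common outer neighbour would close a triangle with the edge xy.\<close>
      have "z \<noteq> t" using tree_triangle_free[OF T, of z x y] e xy(1) by (auto simp: E_def insert_commute)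
      moreover have "x \<in> V" "y \<in> V" "x \<noteq> y" using edge_ends[OF E xy(1)] by auto
      moreover have "z \<in> V" "z \<noteq> x" "z \<noteq> y" "t \<in> V" "t \<noteq> y" "t \<noteq> x"
        using zt nbrs_subset[OF E, of x] nbrs_subset[OF E, of y] by auto
      ultimately show ?thesis
        using zt by (intro blocked[of x y z t]) (auto simp: quads_def switch_def)
    qed

    \<comment> \<open>By \<open>leaves\<close>, the leaves outside \<open>W\<close> share one
      neighbour; if there are none, any vertex serves as \<open>u\<close>.\<close>
    obtain u where u: "u \<in> V" "\<And>v. v \<in> V \<Longrightarrow> v \<notin> W \<Longrightarrow> d v = 1 \<Longrightarrow> u \<in> nbrs E v"
    proof (cases "\<exists>l\<in>V. l \<notin> W \<and> d l = 1")
      case True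
      then obtain l where l: "l \<in> V" "l \<notin> W" "d l = 1" by blast
      then obtain p where p: "nbrs E l = {p}" by (auto simp: d_def card_1_singleton_iff)
      have "p \<in> nbrs E v" if v: "v \<in> V" "v \<notin> W" "d v = 1" for v
      proof -
        obtain q where q: "nbrs E v = {q}" using v by (auto simp: d_def card_1_singleton_iff)
        then show ?thesis using leaves[OF l(1) v(1) p q] l v p by auto
      qed
      moreover have "p \<in> V" using nbrs_subset[OF E, of l] p by auto
      ultimately show ?thesis using that by blast
    next
      case False
      then show ?thesis using that Vne by blast
    qed
    define R where "R = V - {u}"
    \<comment> \<open>These three sets will meet every edge avoiding \<open>u\<close>. The first two
      lie in \<open>W\<close>, and the degree sum over the third is controlled by the size of the
      first.\<close>
    define A1 where "A1 = {v \<in> R. d v = 1 \<and> u \<notin> nbrs E v}"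
    define A2 where "A2 = {v \<in> W. d v = 2}"
    define A3 where "A3 = {v \<in> R. d v \<ge> 3}"
    have fR: "finite R" using V by (simp add: R_def)
    have fA: "finite A1" "finite A2" "finite A3" using fR fW by (simp_all add: A1_def A2_def A3_def)
    have A1W: "A1 \<subseteq> W" using u(2) by (auto simp: A1_def R_def)
    have c12: "card A1 \<le> card W" "card A2 \<le> card W"
      using A1W fW by (auto simp: A2_def intro!: card_mono)
    have cE: "card E + 1 = card V" using tree_card_edges[OF T] by (simp add: E_def V_def)

    \<comment> \<open>Over \<open>R\<close>, which has as many elements as \<open>E\<close>, the
      values d v - 2 sum to -d u. The negative terms come from leaves, and those outside
      \<open>A1\<close> are neighbours of \<open>u\<close>, at most d u in number, so they cancel
      against d u.\<close>
    have excess: "(\<Sum>v\<in>A3. int (d v) - 2) \<le> int (card A1)"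
    proof -
      have "(\<Sum>v\<in>R. int (d v) - 2) + int (d u) = 2 * int (card E) - 2 * int (card R)"
      proof -
        have "(\<Sum>v\<in>R. d v) + d u = 2 * card E"
          using sum_card_nbrs[OF V E] sum.remove[OF V u(1), of d] by (simp add: d_def R_def)
        then have "(\<Sum>v\<in>R. int (d v)) + int (d u) = 2 * int (card E)" by (metis of_nat_add of_nat_mult of_nat_numeral of_nat_sum)
        then show ?thesis by (simp add: sum_subtractf)
      qed
      moreover have "card R = card E" using cE V u(1) by (simp add: R_def)
      ultimately have sumR: "(\<Sum>v\<in>R. int (d v) - 2) = - int (d u)" by simp
      let ?L = "{v \<in> R. d v = 1}"
      have "(\<Sum>v\<in>A3. int (d v) - 2) - int (card ?L)
          = (\<Sum>v\<in>R. (if v \<in> A3 then int (d v) - 2 else 0) - (if v \<in> ?L then 1 else 0))"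
      proof -
        have "(\<Sum>v\<in>R. if v \<in> A3 then int (d v) - 2 else 0) = (\<Sum>v\<in>A3. int (d v) - 2)"
          using fR by (simp add: A3_def sum.inter_filter)
        moreover have "(\<Sum>v\<in>R. if v \<in> ?L then 1 else 0) = int (card ?L)"
          using fR by (simp add: sum.inter_filter [symmetric])
        ultimately show ?thesis by (simp add: sum_subtractf)
      qed
      also have "\<dots> \<le> (\<Sum>v\<in>R. int (d v) - 2)"
      proof (rule sum_mono)
        fix v assume v: "v \<in> R"
        then have "d v \<ge> 1" using dpos[of v] n3 by (simp add: R_def)
        then show "(if v \<in> A3 then int (d v) - 2 else 0) - (if v \<in> ?L then 1 else 0) \<le> int (d v) - 2"
          using v by (auto simp: A3_def)
      qed
      finally have "(\<Sum>v\<in>A3. int (d v) - 2) \<le> int (card ?L) - int (d u)" using sumR by simp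
      moreover have "card ?L \<le> card A1 + d u"
      proof -
        have "?L \<subseteq> A1 \<union> nbrs E u" using nbrs_sym by (fastforce simp: A1_def)
        then have "card ?L \<le> card (A1 \<union> nbrs E u)" using fA fN by (intro card_mono) auto
        also have "\<dots> \<le> card A1 + d u" unfolding d_def by (rule card_Un_le)
        finally show ?thesis .
      qed
      ultimately show ?thesis by simp
    qed
    have sum3: "(\<Sum>v\<in>A3. d v) \<le> 3 * card A1"
    proof -
      \<comment> \<open>A degree d of at least 3 satisfies d \<le> 3(d - 2).\<close>
      have "(\<Sum>v\<in>A3. int (d v)) \<le> (\<Sum>v\<in>A3. 3 * (int (d v) - 2))"
        by (rule sum_mono) (simp add: A3_def)
      also have "\<dots> \<le> 3 * int (card A1)" using excess by (simp only: sum_distrib_left [symmetric])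
      finally have "int (\<Sum>v\<in>A3. d v) \<le> int (3 * card A1)" by simp
      then show ?thesis by (simp only: of_nat_le_iff)
    qed

    \<comment> \<open>If both ends have degree 2, \<open>paths\<close> puts one into
      \<open>A2\<close>. Otherwise some end has degree at least 3, or is a leaf whose only neighbour
      differs from \<open>u\<close>.\<close>
    have cover: "{e \<in> E. u \<notin> e} \<subseteq> (\<Union>v\<in>A1 \<union> A2 \<union> A3. {e \<in> E. v \<in> e})"
    proof
      fix e assume e: "e \<in> {e \<in> E. u \<notin> e}"
      then have eE: "e \<in> E" by simp
      obtain x y where xy: "e = {x, y}" "x \<noteq> y" "x \<in> V" "y \<in> V" by (rule edge_cases[OF E eE])
      have R: "x \<in> R" "y \<in> R" using e xy by (auto simp: R_def)
      have n: "y \<in> nbrs E x" "x \<in> nbrs E y" using nbrs_pair[of x y E] eE xy by auto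
      have leaf: "a \<in> A1" if "a \<in> R" "d a = 1" "b \<in> nbrs E a" "b \<noteq> u" for a b
        using that by (auto simp: A1_def d_def card_1_singleton_iff)
      have pos: "d x \<ge> 1" "d y \<ge> 1" using dpos xy n3 by auto
      have "x \<in> A1 \<union> A2 \<union> A3 \<or> y \<in> A1 \<union> A2 \<union> A3"
      proof (cases "d x = 2 \<and> d y = 2")
        case True
        then show ?thesis using paths[of x y] eE xy by (auto simp: A2_def)
      next
        case False
        then consider "d x = 1" | "d y = 1" | "d x \<ge> 3" | "d y \<ge> 3" using pos by linarith
        then show ?thesis using leaf[of x y] leaf[of y x] R n by cases (auto simp: A3_def R_def)
      qed
      then show "e \<in> (\<Union>v\<in>A1 \<union> A2 \<union> A3. {e \<in> E. v \<in> e})" using eE xy by auto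
    qed
    have "card {e \<in> E. u \<notin> e} \<le> card (\<Union>v\<in>A1 \<union> A2 \<union> A3. {e \<in> E. v \<in> e})"
      using cover fE fA by (intro card_mono) auto
    also have "\<dots> \<le> (\<Sum>v\<in>A1 \<union> A2 \<union> A3. d v)"
      using card_UN_le[of "A1 \<union> A2 \<union> A3" "\<lambda>v. {e \<in> E. v \<in> e}"] fA card_incident[OF E]
      by (simp add: d_def)
    also have "\<dots> \<le> (\<Sum>v\<in>A1. d v) + (\<Sum>v\<in>A2. d v) + (\<Sum>v\<in>A3. d v)"
      using sum_Un_nat[of "A1 \<union> A2" A3 d] sum_Un_nat[of A1 A2 d] fA by simp
    also have "\<dots> \<le> card A1 + 2 * card A2 + 3 * card A1"
      using sum3 by (simp add: A1_def A2_def)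
    \<comment> \<open>The coefficients 1 + 2 + 3 = 6 multiply card W, and each switch contributes at
      most 4 vertices to \<open>W\<close>.\<close>
    also have "\<dots> \<le> 24 * card Q" using c12 cW by linarith
    finally have "card {e \<in> E. u \<notin> e} \<le> 24 * card Q" .
    moreover have "card E = card {e \<in> E. u \<in> e} + card {e \<in> E. u \<notin> e}"
    proof -
      have "E = {e \<in> E. u \<in> e} \<union> {e \<in> E. u \<notin> e}" by auto
      then show ?thesis using card_Un_disjoint[of "{e \<in> E. u \<in> e}" "{e \<in> E. u \<notin> e}"] fE by auto
    qed
    moreover have "card {e \<in> E. u \<in> e} \<le> max_degree T"
      using dmax[OF u(1)] card_incident[OF E, of u] by (simp add: d_def)
    ultimately have "card V \<le> 1 + max_degree T + 24 * card Q" using cE by linarith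
    then show ?thesis using Q by (auto simp: P_def V_def E_def)
  qed
qed

section \<open>Quadruples with positive gain\<close>

definition gainful :: "'a set set \<Rightarrow> 'a set \<Rightarrow> ('a \<times> 'a \<times> 'a \<times> 'a) set" where
  "gainful G V = {s \<in> quads V. swap_gain G s \<ge> 1}"

text \<open>Since exchanging \<open>x\<close> and \<open>y\<close> negates the gain, all alternating
  sums vanish: the difference between the adjacencies of \<open>x\<close> and \<open>y\<close> to a
  third vertex is constant. If it is nonzero for some pair, one of the two is joined to all others
  and the other to none, which leads to a star or its complement; if it is always zero,
  \<open>G\<close> is empty or complete.\<close>

lemma gainful_empty_structure:
  assumes G: "G \<subseteq> [V]\<^bsup>2\<^esup>" and V: "card V \<ge> 4" and none: "gainful G V = {}"
  shows "G = {} \<or> G = [V]\<^bsup>2\<^esup> \<or> (\<exists>x\<in>V. G = {e \<in> [V]\<^bsup>2\<^esup>. x \<in> e}) \<or> (\<exists>x\<in>V. G = {e \<in> [V]\<^bsup>2\<^esup>. x \<notin> e})"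
proof -
  define a where "a u v \<longleftrightarrow> {u, v} \<in> G" for u v
  have sym: "a u v = a v u" for u v by (simp add: a_def insert_commute)
  have flat: "of_bool (a y z) + of_bool (a x t) = (of_bool (a x z) + of_bool (a y t) :: int)"
    if "distinct [x, y, z, t]" "{x, y, z, t} \<subseteq> V" for x y z t
  proof -
    have "(x, y, z, t) \<in> quads V" "(y, x, z, t) \<in> quads V" using that by (auto simp: quads_def)
    then have "swap_gain G (x, y, z, t) \<le> 0" "swap_gain G (y, x, z, t) \<le> 0" using none by (force simp: gainful_def)+
    then show ?thesis by (simp add: swap_gain_def a_def)
  qed
  have shift: "a x t \<and> \<not> a y t"
    if "distinct [x, y, z, t]" "{x, y, z, t} \<subseteq> V" "a x z" "\<not> a y z" for x y z t
    using flat[OF that(1,2)] that(3,4) by (auto simp: of_bool_def split: if_splits)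
  have ext: "G = {e \<in> [V]\<^bsup>2\<^esup>. P e}"
    if "\<And>u v. u \<in> V \<Longrightarrow> v \<in> V \<Longrightarrow> u \<noteq> v \<Longrightarrow> a u v \<longleftrightarrow> P {u, v}" for P
    using that G unfolding a_def nsets_2_eq by blast
  show ?thesis
  proof (cases "\<exists>x\<in>V. \<exists>y\<in>V. \<exists>z\<in>V. distinct [x, y, z] \<and> a x z \<and> \<not> a y z")
    case True
    then obtain x y z where xyz: "x \<in> V" "y \<in> V" "z \<in> V" "x \<noteq> y" "x \<noteq> z" "y \<noteq> z" "a x z" "\<not> a y z"
      by auto
    have xy: "a x v \<and> \<not> a y v" if "v \<in> V" "v \<noteq> x" "v \<noteq> y" for v
      using shift[of x y z v] xyz that by (cases "v = z") auto
    show ?thesis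
    \<comment> \<open>One edge avoiding \<open>x\<close> and \<open>y\<close> forces every pair
      avoiding \<open>y\<close> into \<open>G\<close>, the complement of a star at \<open>y\<close>;
      without such an edge \<open>G\<close> is the star at \<open>x\<close>.\<close>
    proof (cases "\<exists>u\<in>V. \<exists>v\<in>V. distinct [x, y, u, v] \<and> a u v")
      case True
      then obtain u v where uv: "u \<in> V" "v \<in> V" "distinct [x, y, u, v]" "a u v" by auto
      have nxy: "\<not> a x y"
        using shift[of u y v x] xy[of v] uv xyz sym[of x y] by auto
      have u1: "a u w" if "w \<in> V" "w \<noteq> u" "w \<noteq> y" for w
        using shift[of u y v w] xy[of v] uv that xyz by (cases "w = v") auto
      have "a p q" if "p \<in> V" "q \<in> V" "p \<noteq> q" "p \<noteq> y" "q \<noteq> y" for p q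
      proof (cases "p \<in> {x, u} \<or> q \<in> {x, u}")
        case True
        then show ?thesis using xy[of p] xy[of q] u1[of p] u1[of q] that sym[of p q] by auto
      next
        case False
        then show ?thesis
          using shift[of x p q u] xy[of q] u1[of p] that uv xyz sym[of p u] by auto
      qed
      moreover have "\<not> a y q" if "q \<in> V" "q \<noteq> y" for q
        using xy[of q] nxy sym[of y q] that by (cases "q = x") auto
      ultimately have "G = {e \<in> [V]\<^bsup>2\<^esup>. y \<notin> e}"
        using sym by (intro ext) blast
      then show ?thesis using xyz by blast
    next
      case False
      \<comment> \<open>Here four vertices are used: \<open>v\<close> separates \<open>x\<close>
        from \<open>u\<close>, hence so does \<open>y\<close>, which settles the pair xy.\<close>
      have "card (V - {x, y}) \<ge> 2" using V xyz by (simp add: card_Diff_subset)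
      then obtain S where "S \<subseteq> V - {x, y}" "card S = 2" by (rule obtain_subset_with_card_n)
      then obtain u v where uv: "u \<in> V - {x, y}" "v \<in> V - {x, y}" "u \<noteq> v"
        by (auto simp: card_2_iff)
      have axy: "a x y"
        using shift[of x u v y] False xy[of v] uv xyz by fastforce
      have "a p q \<longleftrightarrow> x \<in> {p, q}" if "p \<in> V" "q \<in> V" "p \<noteq> q" for p q
      proof (cases "x \<in> {p, q}")
        case True
        then show ?thesis using xy[of p] xy[of q] axy sym[of p q] that by auto
      next
        case outer: False
        then show ?thesis using False xy[of p] xy[of q] sym[of p q] that by auto
      qed
      then have "G = {e \<in> [V]\<^bsup>2\<^esup>. x \<in> e}" by (intro ext) auto
      then show ?thesis using xyz by blast
    qed
  next
    case False
    then have mv: "a x z \<Longrightarrow> a y z" if "x \<in> V" "y \<in> V" "z \<in> V" "x \<noteq> z" "y \<noteq> z" for x y z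
      using that by (cases "x = y") auto
    show ?thesis
    proof (cases "\<exists>p\<in>V. \<exists>q\<in>V. p \<noteq> q \<and> a p q")
      case True
      then obtain p q where pq: "p \<in> V" "q \<in> V" "p \<noteq> q" "a p q" by blast
      have "a u v" if "u \<in> V" "v \<in> V" "u \<noteq> v" for u v
      proof (cases "u = q")
        case True
        then show ?thesis using mv[of p v q] pq that sym by auto
      next
        case False
        then have "a q u" using mv[of p u q] pq that sym by auto
        then show ?thesis using mv[of q v u] False pq that sym by auto
      qed
      then have "G = {e \<in> [V]\<^bsup>2\<^esup>. True}" by (intro ext) auto
      then show ?thesis by simp
    next
      case False
      then have "G = {e \<in> [V]\<^bsup>2\<^esup>. False}" by (intro ext) auto
      then show ?thesis by simp
    qed
  qed
qed

text \<open>Restricted to \<open>S\<close>, the graph is none of the four exceptional ones: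
  \<open>e1\<close> and \<open>f1\<close> exclude the empty and the complete graph, two disjoint
  edges exclude a star, and two disjoint non-edges exclude the complement of a star.\<close>

lemma gainful_in_union:
  assumes S: "finite S" and e: "e1 \<in> G" "e2 \<in> G" "e1 \<inter> e2 = {}" "e1 \<in> [S]\<^bsup>2\<^esup>" "e2 \<in> [S]\<^bsup>2\<^esup>"
    and f: "f1 \<in> [S]\<^bsup>2\<^esup> - G" "f2 \<in> [S]\<^bsup>2\<^esup> - G" "f1 \<inter> f2 = {}"
  shows "gainful G S \<noteq> {}"
proof
  assume none: "gainful G S = {}"
  let ?G = "G \<inter> [S]\<^bsup>2\<^esup>"
  have "swap_gain ?G s = swap_gain G s" if "s \<in> quads S" for s
    using that by (auto simp: swap_gain_def quads_def)
  then have "gainful ?G S = {}" using none by (auto simp: gainful_def)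
  moreover have "card S \<ge> 4"
  proof -
    have "card (e1 \<union> e2) = 4" using e by (subst card_Un_disjoint) (auto simp: nsets_def)
    moreover have "card (e1 \<union> e2) \<le> card S" using e S by (intro card_mono) (auto simp: nsets_def)
    ultimately show ?thesis by simp
  qed
  ultimately show False
    using gainful_empty_structure[of ?G S] e f by blast
qed

section \<open>Counting quadruples of positive gain\<close>

text \<open>An edge meeting {a, b} has the form {a, v} or {b, v}, so at most 2 * card V edges are
  lost for each first choice. Where the natural subtraction truncates, the bound is trivial.\<close>

lemma disjoint_pairs_ge:
  assumes V: "finite V" and G: "G \<subseteq> [V]\<^bsup>2\<^esup>"
  shows "card {(e1, e2). e1 \<in> G \<and> e2 \<in> G \<and> e1 \<inter> e2 = {}} \<ge> card G * (card G - 2 * card V)"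
proof -
  have fG: "finite G" using finite_edges[OF V G] .
  have "card G - 2 * card V \<le> card {e2 \<in> G. e1 \<inter> e2 = {}}" if e1: "e1 \<in> G" for e1
  proof -
    obtain a b where ab: "e1 = {a, b}" by (rule edge_cases[OF G e1])
    have "{e2 \<in> G. e1 \<inter> e2 \<noteq> {}} \<subseteq> (\<lambda>v. {a, v}) ` V \<union> (\<lambda>v. {b, v}) ` V"
    proof
      fix e assume e: "e \<in> {e2 \<in> G. e1 \<inter> e2 \<noteq> {}}"
      then have "e \<in> G" by simp
      then obtain u v where "e = {u, v}" "u \<in> V" "v \<in> V" by (rule edge_cases[OF G])
      then show "e \<in> (\<lambda>v. {a, v}) ` V \<union> (\<lambda>v. {b, v}) ` V" using e ab by auto
    qed
    then have "card {e2 \<in> G. e1 \<inter> e2 \<noteq> {}} \<le> card ((\<lambda>v. {a, v}) ` V \<union> (\<lambda>v. {b, v}) ` V)"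
      using V by (intro card_mono) auto
    also have "\<dots> \<le> card ((\<lambda>v. {a, v}) ` V) + card ((\<lambda>v. {b, v}) ` V)" by (rule card_Un_le)
    also have "\<dots> \<le> 2 * card V"
      using card_image_le[OF V, of "\<lambda>v. {a, v}"] card_image_le[OF V, of "\<lambda>v. {b, v}"] by linarith
    finally have "card {e2 \<in> G. e1 \<inter> e2 \<noteq> {}} \<le> 2 * card V" .
    moreover have "card G = card ({e2 \<in> G. e1 \<inter> e2 = {}} \<union> {e2 \<in> G. e1 \<inter> e2 \<noteq> {}})"
      by (rule arg_cong[where f = card]) auto
    moreover have "\<dots> = card {e2 \<in> G. e1 \<inter> e2 = {}} + card {e2 \<in> G. e1 \<inter> e2 \<noteq> {}}"
      using fG by (intro card_Un_disjoint) auto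
    ultimately show ?thesis by linarith
  qed
  then have "card G * (card G - 2 * card V) \<le> (\<Sum>e1\<in>G. card {e2 \<in> G. e1 \<inter> e2 = {}})"
    using sum_bounded_below[of G "card G - 2 * card V" "\<lambda>e1. card {e2 \<in> G. e1 \<inter> e2 = {}}"] by simp
  also have "\<dots> = card (Sigma G (\<lambda>e1. {e2 \<in> G. e1 \<inter> e2 = {}}))"
    using fG by (intro card_SigmaI [symmetric]) auto
  also have "Sigma G (\<lambda>e1. {e2 \<in> G. e1 \<inter> e2 = {}}) = {(e1, e2). e1 \<in> G \<and> e2 \<in> G \<and> e1 \<inter> e2 = {}}"
    by auto
  finally show ?thesis .
qed

text \<open>The quadruple at four distinct positions together with the values at the other four
  positions determines \<open>F\<close>. For repeated positions no quadruple is distinct and the set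
  is empty.\<close>

lemma card_gainful_coordinates:
  fixes G :: "'a set set"
  assumes V: "finite V" and ijkl: "i < 8" "j < 8" "k < 8" "l < (8::nat)"
  shows "card {F \<in> {..<8} \<rightarrow>\<^sub>E V. (F i, F j, F k, F l) \<in> gainful G V} \<le> card (gainful G V) * card V ^ 4"
proof (cases "distinct [i, j, k, l]")
  case True
  let ?R = "{..<8} - {i, j, k, l}"
  let ?h = "\<lambda>F. ((F i, F j, F k, F l), restrict F ?R)"
  have fg: "finite (gainful G V)" using finite_quads[OF V] by (simp add: gainful_def)
  have fR: "finite (?R \<rightarrow>\<^sub>E V)" using V by (intro finite_PiE) auto
  have "card {F \<in> {..<8} \<rightarrow>\<^sub>E V. (F i, F j, F k, F l) \<in> gainful G V} \<le> card (gainful G V \<times> (?R \<rightarrow>\<^sub>E V))"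
  proof (rule card_inj_on_le[where f = ?h])
    show "inj_on ?h {F \<in> {..<8} \<rightarrow>\<^sub>E V. (F i, F j, F k, F l) \<in> gainful G V}"
    proof (rule inj_onI)
      fix F F' assume F: "F \<in> {F \<in> {..<8} \<rightarrow>\<^sub>E V. (F i, F j, F k, F l) \<in> gainful G V}"
        and F': "F' \<in> {F \<in> {..<8} \<rightarrow>\<^sub>E V. (F i, F j, F k, F l) \<in> gainful G V}" and eq: "?h F = ?h F'"
      show "F = F'"
      proof (rule PiE_ext[of F _ "\<lambda>_. V"])
        fix m :: nat assume m: "m \<in> {..<8}"
        show "F m = F' m"
        proof (cases "m \<in> ?R")
          case True
          then have "restrict F ?R m = restrict F' ?R m" using eq by simp
          then show ?thesis using True by simp
        qed (use eq m in auto)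
      qed (use F F' in auto)
    qed
    show "?h ` {F \<in> {..<8} \<rightarrow>\<^sub>E V. (F i, F j, F k, F l) \<in> gainful G V} \<subseteq> gainful G V \<times> (?R \<rightarrow>\<^sub>E V)"
    proof (rule image_subsetI)
      fix F assume "F \<in> {F \<in> {..<8} \<rightarrow>\<^sub>E V. (F i, F j, F k, F l) \<in> gainful G V}"
      then have F: "F \<in> {..<8} \<rightarrow>\<^sub>E V" "(F i, F j, F k, F l) \<in> gainful G V" by simp_all
      have "\<forall>m\<in>?R. F m \<in> V" using PiE_mem[OF F(1)] by blast
      then have "restrict F ?R \<in> ?R \<rightarrow>\<^sub>E V" by (simp only: restrict_PiE_iff)
      with F(2) show "?h F \<in> gainful G V \<times> (?R \<rightarrow>\<^sub>E V)" by (rule SigmaI)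
    qed
  qed (intro finite_cartesian_product fg fR)
  also have "\<dots> = card (gainful G V) * card V ^ card ?R"
    by (simp only: card_cartesian_product card_PiE finite_Diff finite_lessThan prod_constant)
  also have "card ?R = 4"
  proof -
    have "card {i, j, k, l} = 4" using True by simp
    moreover have "{i, j, k, l} \<subseteq> {..<8}" using ijkl by simp
    ultimately show ?thesis by (simp add: card_Diff_subset del: insert_subset)
  qed
  finally show ?thesis .
next
  case False
  then have none: "{F \<in> {..<8} \<rightarrow>\<^sub>E V. (F i, F j, F k, F l) \<in> gainful G V} = {}"
    by (auto simp: gainful_def quads_def)
  show ?thesis unfolding none by simp
qed

text \<open>Two disjoint edges and two disjoint non-edges span at most eight vertices, listed by a
  function on \<open>{..<8}\<close>; four of its values form a quadruple of positive gain.\<close>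

lemma card_gainful_ge:
  assumes V: "finite V" and G: "G \<subseteq> [V]\<^bsup>2\<^esup>" and H: "H = [V]\<^bsup>2\<^esup> - G"
  shows "card G * (card G - 2 * card V) * (card H * (card H - 2 * card V))
    \<le> 4096 * card (gainful G V) * card V ^ 4"
proof -
  let ?D = "\<lambda>G. {(e1, e2). e1 \<in> G \<and> e2 \<in> G \<and> e1 \<inter> e2 = {}}"
  define B where "B = (\<lambda>(i, j, k, l). {F \<in> {..<8::nat} \<rightarrow>\<^sub>E V. (F i, F j, F k, F l) \<in> gainful G V})"
  let ?I = "{..<8::nat} \<times> {..<8::nat} \<times> {..<8::nat} \<times> {..<8::nat}"
  define dec where "dec F = (({F 0, F 1}, {F 2, F 3}), ({F 4, F 5}, {F 6, F 7}))" for F :: "nat \<Rightarrow> 'a"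
  have H': "H \<subseteq> [V]\<^bsup>2\<^esup>" using H by auto
  have fB: "finite (\<Union> (B ` ?I))"
    by (rule finite_subset[of _ "{..<8} \<rightarrow>\<^sub>E V"]) (use V in \<open>auto simp: B_def intro: finite_PiE\<close>)
  have "?D G \<times> ?D H \<subseteq> dec ` \<Union> (B ` ?I)"
  proof
    fix c assume "c \<in> ?D G \<times> ?D H"
    then obtain e1 e2 f1 f2 where c: "c = ((e1, e2), (f1, f2))" "e1 \<in> G" "e2 \<in> G" "e1 \<inter> e2 = {}"
      "f1 \<in> H" "f2 \<in> H" "f1 \<inter> f2 = {}" by auto
    obtain a0 a1 where a1: "e1 = {a0, a1}" "a0 \<in> V" "a1 \<in> V" by (rule edge_cases[OF G c(2)])
    obtain a2 a3 where a2: "e2 = {a2, a3}" "a2 \<in> V" "a3 \<in> V" by (rule edge_cases[OF G c(3)])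
    obtain a4 a5 where a3: "f1 = {a4, a5}" "a4 \<in> V" "a5 \<in> V" by (rule edge_cases[OF H' c(5)])
    obtain a6 a7 where a4: "f2 = {a6, a7}" "a6 \<in> V" "a7 \<in> V" by (rule edge_cases[OF H' c(6)])
    let ?l = "[a0, a1, a2, a3, a4, a5, a6, a7]"
    define F where "F = restrict (\<lambda>i. ?l ! i) {..<8}"
    have FV: "F \<in> {..<8} \<rightarrow>\<^sub>E V"
    proof -
      have "?l ! i \<in> V" if "i < 8" for i
      proof -
        have "?l ! i \<in> set ?l" using that by (intro nth_mem) simp
        then show ?thesis using a1 a2 a3 a4 by auto
      qed
      then show ?thesis by (auto simp: F_def)
    qed
    have dec: "dec F = c" by (simp add: dec_def F_def c a1 a2 a3 a4 eval_nat_numeral)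
    \<comment> \<open>Working inside the listed vertices ensures that the quadruple found consists
      of values of \<open>F\<close>.\<close>
    let ?S = "F ` {..<8}"
    have S: "F i \<in> ?S" if "i < 8" for i using that by auto
    have "gainful G ?S \<noteq> {}"
    proof (rule gainful_in_union[of _ e1 G e2 f1 f2])
      have sub: "{F i, F j} \<in> [?S]\<^bsup>2\<^esup>" if "{F i, F j} \<in> [V]\<^bsup>2\<^esup>" "i < 8" "j < 8" for i j
        using that S by auto
      have "{F 0, F 1} = e1" "{F 2, F 3} = e2" "{F 4, F 5} = f1" "{F 6, F 7} = f2"
        using dec c by (auto simp: dec_def)
      then show "e1 \<in> [?S]\<^bsup>2\<^esup>" "e2 \<in> [?S]\<^bsup>2\<^esup>" "f1 \<in> [?S]\<^bsup>2\<^esup> - G" "f2 \<in> [?S]\<^bsup>2\<^esup> - G"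
        using sub[of 0 1] sub[of 2 3] sub[of 4 5] sub[of 6 7] c G H by auto
    qed (use c in auto)
    then obtain x y z t where q: "(x, y, z, t) \<in> gainful G ?S" by auto
    then have "{x, y, z, t} \<subseteq> ?S" by (auto simp: gainful_def quads_def)
    then obtain i j k l where ijkl: "i < 8" "j < 8" "k < 8" "l < 8" "x = F i" "y = F j" "z = F k" "t = F l"
      by auto
    have "?S \<subseteq> V" using FV by auto
    then have "gainful G ?S \<subseteq> gainful G V" by (auto simp: gainful_def quads_def)
    then have "F \<in> B (i, j, k, l)" using q FV ijkl by (auto simp: B_def)
    then have F: "F \<in> \<Union> (B ` ?I)" using ijkl by blast
    show "c \<in> dec ` \<Union> (B ` ?I)" using F dec by blast
  qed
  then have "card (?D G \<times> ?D H) \<le> card (\<Union> (B ` ?I))" by (rule surj_card_le[OF fB])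
  also have "\<dots> \<le> (\<Sum>s\<in>?I. card (B s))" by (intro card_UN_le) auto
  also have "\<dots> \<le> (\<Sum>s\<in>?I. card (gainful G V) * card V ^ 4)"
    using card_gainful_coordinates[OF V, of _ _ _ _ G] by (intro sum_mono) (auto simp: B_def)
  \<comment> \<open>There are 8^4 = 4096 choices of four positions.\<close>
  also have "\<dots> = 4096 * card (gainful G V) * card V ^ 4" by (simp add: card_cartesian_product)
  finally have "card (?D G) * card (?D H) \<le> 4096 * card (gainful G V) * card V ^ 4"
    by (simp only: card_cartesian_product)
  moreover have "card G * (card G - 2 * card V) * (card H * (card H - 2 * card V)) \<le> card (?D G) * card (?D H)"
    using disjoint_pairs_ge[OF V G] disjoint_pairs_ge[OF V H'] by (intro mult_mono) auto
  ultimately show ?thesis by linarith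
qed

section \<open>The embedding\<close>

lemma choose_two_int: "2 * int (n choose 2) = int n * (int n - 1)"
proof -
  have "even (n * (n - 1))" by (cases "even n") auto
  then have "2 * (n choose 2) = n * (n - 1)" by (simp only: choose_two dvd_mult_div_cancel)
  then have "int (2 * (n choose 2)) = int (n * (n - 1))" by (simp only:)
  then show ?thesis by (cases n) (simp_all add: algebra_simps)
qed

lemma choose_two_real: "real (n choose 2) = real n * (real n - 1) / 2"
proof -
  have "real_of_int (2 * int (n choose 2)) = real_of_int (int n * (int n - 1))"
    by (simp only: choose_two_int)
  then show ?thesis by simp
qed

lemma sum_hits:
  assumes V: "finite V" and E: "E \<subseteq> [V]\<^bsup>2\<^esup>" and G: "G \<subseteq> [V]\<^bsup>2\<^esup>"
  shows "int (card V choose 2) * (\<Sum>p | p permutes V. hits E G p) = int (card E * fact (card V) * card G)"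
proof -
  have "int (card V choose 2) * (\<Sum>p | p permutes V. hits E G p)
      = (\<Sum>e\<in>E. int (card V choose 2) * (\<Sum>p | p permutes V. of_bool (p ` e \<in> G)))"
    unfolding hits_def by (subst sum.swap) (simp only: sum_distrib_left)
  also have "\<dots> = (\<Sum>e\<in>E. int (fact (card V) * card G))"
  proof (rule sum.cong[OF refl])
    fix e assume "e \<in> E"
    then have "e \<in> [V]\<^bsup>2\<^esup>" using E by blast
    then have "int (card V choose 2) * (\<Sum>p | p permutes V. of_bool (p ` e \<in> G))
        = of_nat (fact (card V)) * (\<Sum>e\<in>[V]\<^bsup>2\<^esup>. of_bool (e \<in> G))"
      using sum_permutes_edge[OF V, of e "\<lambda>e. of_bool (e \<in> G) :: int"] by simp
    also have "(\<Sum>e\<in>[V]\<^bsup>2\<^esup>. of_bool (e \<in> G) :: int) = int (card G)"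
      using V G by (simp add: finite_imp_finite_nsets Int_absorb1 Int_absorb2)
    finally show "int (card V choose 2) * (\<Sum>p | p permutes V. of_bool (p ` e \<in> G)) = int (fact (card V) * card G)"
      by simp
  qed
  also have "\<dots> = int (card E * fact (card V) * card G)" by simp
  finally show ?thesis .
qed

text \<open>The image of a fixed quadruple is equidistributed on \<open>quads V\<close>. Bounding
  the size of \<open>quads V\<close> by the fourth power of card V gives a simple
  denominator.\<close>

lemma sum_gainful:
  assumes V: "finite V" and s: "s \<in> quads V"
  shows "real (\<Sum>p | p permutes V. of_bool (map4 p s \<in> gainful G V)) * real (card V) ^ 4
    \<ge> fact (card V) * real (card (gainful G V))"
proof -
  have eq: "card (quads V) * (\<Sum>p | p permutes V. of_bool (map4 p s \<in> gainful G V)) = fact (card V) * card (gainful G V)"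
    using sum_permutes_quad[OF V s, of "\<lambda>s. of_bool (s \<in> gainful G V) :: nat"] finite_quads[OF V]
    by (simp add: gainful_def Int_def)
  have "card (quads V) \<le> card (V \<times> V \<times> V \<times> V)"
    using V by (intro card_mono) (auto simp: quads_def)
  then have "card (quads V) \<le> card V ^ 4" by (simp add: card_cartesian_product eval_nat_numeral)
  then have "fact (card V) * card (gainful G V)
      \<le> card V ^ 4 * (\<Sum>p | p permutes V. of_bool (map4 p s \<in> gainful G V))"
    unfolding eq [symmetric] by (rule mult_right_mono) simp
  then have "real (fact (card V) * card (gainful G V))
      \<le> real (card V ^ 4 * (\<Sum>p | p permutes V. of_bool (map4 p s \<in> gainful G V)))"
    by (simp only: of_nat_le_iff)
  then show ?thesis by (simp add: mult.commute)
qed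

text \<open>Every placement improved by its helpful switches is still bounded by \<open>M\<close>;
  averaging over all placements gives the mean of \<open>hits\<close> plus, for each switch, the
  proportion of placements in which it helps.\<close>

lemma max_hits_ge:
  assumes V: "finite V" "card V \<ge> 2" and E: "E \<subseteq> [V]\<^bsup>2\<^esup>" "card E + 1 = card V" and G: "G \<subseteq> [V]\<^bsup>2\<^esup>"
    and Q: "\<forall>s\<in>Q. switch E s" "Q \<subseteq> quads V" "noninterfering Q"
    and M: "\<And>p. p permutes V \<Longrightarrow> hits E G p \<le> M"
  shows "real_of_int M \<ge> 2 * real (card G) / real (card V) + real (card Q) * real (card (gainful G V)) / real (card V) ^ 4"
proof -
  let ?n = "card V" and ?S = "{p. p permutes V}"
  let ?c = "\<lambda>s. (\<Sum>p\<in>?S. of_bool (map4 p s \<in> gainful G V)) :: nat"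
  have fQ: "finite Q" using Q(2) finite_quads[OF V(1)] finite_subset by blast
  \<comment> \<open>Each helpful switch is credited with 1 only, the least positive integer
    gain.\<close>
  have step: "hits E G p + (\<Sum>s\<in>Q. int (of_bool (map4 p s \<in> gainful G V))) \<le> M" if p: "p \<in> ?S" for p
  proof -
    have "support s \<subseteq> V" if "s \<in> Q" for s
      using Q(2) that by (force simp: quads_def support_def)
    then obtain p' where p': "p' permutes V"
      "hits E G p' \<ge> hits E G p + (\<Sum>s\<in>Q. max 0 (swap_gain G (map4 p s)))"
      using switches_gain[OF V(1) E(1) fQ, of p G] Q p by blast
    have "(\<Sum>s\<in>Q. int (of_bool (map4 p s \<in> gainful G V))) \<le> (\<Sum>s\<in>Q. max 0 (swap_gain G (map4 p s)))"
      by (rule sum_mono) (auto simp: gainful_def)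
    then show ?thesis using p' M[OF p'(1)] by linarith
  qed
  have "(\<Sum>p\<in>?S. hits E G p) + int (\<Sum>s\<in>Q. ?c s)
      = (\<Sum>p\<in>?S. hits E G p + (\<Sum>s\<in>Q. int (of_bool (map4 p s \<in> gainful G V))))"
    by (simp only: sum.distrib of_nat_sum sum.swap[of _ Q])
  also have "\<dots> \<le> (\<Sum>p\<in>?S. M)" using step by (rule sum_mono)
  also have "\<dots> = fact ?n * M" using card_permutations[OF refl V(1)] by simp
  finally have "real_of_int ((\<Sum>p\<in>?S. hits E G p) + int (\<Sum>s\<in>Q. ?c s)) \<le> real_of_int (fact ?n * M)"
    by (simp only: of_int_le_iff)
  then have total: "real_of_int (\<Sum>p\<in>?S. hits E G p) + (\<Sum>s\<in>Q. real (?c s)) \<le> fact ?n * real_of_int M"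
    by simp
  \<comment> \<open>The n - 1 tree edges each hit \<open>G\<close> with probability card G / (n
    choose 2); the factor n - 1 cancels because n \<ge> 2.\<close>
  have mean: "real_of_int (\<Sum>p\<in>?S. hits E G p) = fact ?n * (2 * real (card G) / real ?n)"
  proof -
    have ce: "real (card E) = real ?n - 1" using E(2) by linarith
    have "real_of_int (int (?n choose 2) * (\<Sum>p\<in>?S. hits E G p)) = real_of_int (int (card E * fact ?n * card G))"
      by (simp only: sum_hits[OF V(1) E(1) G])
    then have "real (?n choose 2) * real_of_int (\<Sum>p\<in>?S. hits E G p) = (real ?n - 1) * fact ?n * real (card G)"
      by (simp add: ce del: of_int_sum)
    then have "(real ?n - 1) * (real ?n * real_of_int (\<Sum>p\<in>?S. hits E G p)) = (real ?n - 1) * (2 * fact ?n * real (card G))"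
      unfolding choose_two_real by (simp add: field_simps del: of_int_sum)
    then have "real ?n * real_of_int (\<Sum>p\<in>?S. hits E G p) = 2 * fact ?n * real (card G)"
      using V(2) by (simp del: of_int_sum)
    then show ?thesis using V(2) by (simp add: field_simps del: of_int_sum)
  qed
  have n4: "real ?n ^ 4 > 0" using V(2) by simp
  have "real (card Q) * (fact ?n * real (card (gainful G V)) / real ?n ^ 4) \<le> (\<Sum>s\<in>Q. real (?c s))"
  proof (rule sum_bounded_below)
    fix s assume "s \<in> Q"
    then have "s \<in> quads V" using Q(2) by blast
    then show "fact ?n * real (card (gainful G V)) / real ?n ^ 4 \<le> real (?c s)"
      using sum_gainful[OF V(1), of s G] n4 by (simp only: pos_divide_le_eq)
  qed
  then have "fact ?n * (2 * real (card G) / real ?n + real (card Q) * real (card (gainful G V)) / real ?n ^ 4)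
      \<le> fact ?n * real_of_int M"
    using total mean by (simp add: algebra_simps)
  then show ?thesis by (simp only: mult_le_cancel_left_pos fact_gt_zero)
qed

section \<open>Colour classes without positive gain and colour classes with large
  \<open>m_star\<close>\<close>

lemma card_pairs_through:
  assumes "finite V" "x \<in> V"
  shows "card {e \<in> [V]\<^bsup>2\<^esup>. x \<in> e} = card V - 1"
proof -
  have "nbrs ([V]\<^bsup>2\<^esup>) x = V - {x}" using assms by (auto simp: nbrs_def)
  then show ?thesis using card_incident[of "[V]\<^bsup>2\<^esup>" V x] assms by simp
qed

lemma card_pairs:
  "finite V \<Longrightarrow> card ([V]\<^bsup>2\<^esup>) = card V choose 2"
  using n_subsets[of V 2] by (simp add: nsets_def finite_subset cong: conj_cong)

lemma quads_card_ge:
  assumes "finite V" "s \<in> quads V"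
  shows "card V \<ge> 4"
proof -
  obtain x y z t where s: "s = (x, y, z, t)" by (cases s) auto
  then have "card {x, y, z, t} = 4" using assms by (auto simp: quads_def)
  moreover have "card {x, y, z, t} \<le> card V" using assms s by (intro card_mono) (auto simp: quads_def)
  ultimately show ?thesis by simp
qed

text \<open>Only a star and the complement of a star remain. Twice their sizes are 2n - 2 and n(n -
  3) + 2, so divisibility by n would make n divide 2.\<close>

lemma not_dvd_if_gainful_empty:
  assumes V: "finite V" "card V \<ge> 4" and G: "G \<subseteq> [V]\<^bsup>2\<^esup>" "G \<noteq> {}" "G \<noteq> [V]\<^bsup>2\<^esup>" and none: "gainful G V = {}"
  shows "\<not> int (card V) dvd 2 * int (card G)"
proof
  assume dvd: "int (card V) dvd 2 * int (card G)"
  let ?n = "card V"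
  have fN: "finite ([V]\<^bsup>2\<^esup>)" using V(1) by (rule finite_imp_finite_nsets)
  consider x where "x \<in> V" "G = {e \<in> [V]\<^bsup>2\<^esup>. x \<in> e}" | x where "x \<in> V" "G = {e \<in> [V]\<^bsup>2\<^esup>. x \<notin> e}"
    using gainful_empty_structure[OF G(1) V(2) none] G by blast
  then have "2 * int (card G) = 2 * int ?n - 2 \<or> 2 * int (card G) = int ?n * (int ?n - 3) + 2"
  proof cases
    case 1
    then show ?thesis using card_pairs_through[OF V(1) 1(1)] V(2) by (simp add: of_nat_diff)
  next
    case 2
    have "[V]\<^bsup>2\<^esup> = {e \<in> [V]\<^bsup>2\<^esup>. x \<in> e} \<union> G" "{e \<in> [V]\<^bsup>2\<^esup>. x \<in> e} \<inter> G = {}" using 2 by auto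
    then have "card ([V]\<^bsup>2\<^esup>) = card {e \<in> [V]\<^bsup>2\<^esup>. x \<in> e} + card G"
      using fN 2 by (metis (no_types, lifting) card_Un_disjoint finite_Un)
    then have "int (?n choose 2) = int ?n - 1 + int (card G)"
      using card_pairs[OF V(1)] card_pairs_through[OF V(1) 2(1)] V(2) by (simp add: of_nat_diff)
    then show ?thesis using choose_two_int[of ?n] by (simp add: algebra_simps)
  qed
  then have "int ?n dvd 2"
  proof
    assume "2 * int (card G) = 2 * int ?n - 2"
    then have "2 = int ?n * 2 - 2 * int (card G)" by simp
    then show ?thesis using dvd by (metis dvd_diff dvd_triv_left)
  next
    assume "2 * int (card G) = int ?n * (int ?n - 3) + 2"
    then have "2 = 2 * int (card G) - int ?n * (int ?n - 3)" by simp
    then show ?thesis using dvd by (metis dvd_diff dvd_triv_left)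
  qed
  then show False using V(2) by (auto dest: zdvd_imp_le)
qed

text \<open>When both classes have at least 4n elements, subtracting 2n costs at most half, so
  \<open>card_gainful_ge\<close> bounds (ab)^2 by 2^14 * n^4 times the number of gainful quadruples.
  As ab is the minimum times the maximum and the maximum is of order n^2, the powers of n
  cancel.\<close>

lemma card_gainful_ge_square:
  fixes V :: "'a set"
  assumes V: "finite V" "card V \<ge> 2" and G: "G \<subseteq> [V]\<^bsup>2\<^esup>"
    and large: "m_star (card V) (card G) \<ge> 4 * real (card V)"
  shows "(m_star (card V) (card G))\<^sup>2 \<le> 2 ^ 20 * real (card (gainful G V))"
proof -
  define H where "H = [V]\<^bsup>2\<^esup> - G"
  define a b n where "a = real (card G)" and "b = real (card H)" and "n = real (card V)"
  define \<mu> where "\<mu> = m_star (card V) (card G)"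
  have n: "n \<ge> 2" using V by (simp add: n_def)
  have fN: "finite ([V]\<^bsup>2\<^esup>)" using V(1) by (rule finite_imp_finite_nsets)
  have "card H + card G = card V choose 2"
    using card_pairs[OF V(1)] card_Diff_subset[of G "[V]\<^bsup>2\<^esup>"] G fN finite_subset[OF G fN] card_mono[OF fN G]
    by (simp add: H_def)
  then have ab: "b = real (card V choose 2) - a" unfolding a_def b_def by linarith
  then have sum: "a + b = n * (n - 1) / 2" by (simp add: n_def choose_two_real)
  have \<mu>: "\<mu> = min a b" using ab by (simp add: \<mu>_def m_star_def a_def)
  have ge: "a \<ge> 4 * n" "b \<ge> 4 * n" "\<mu> \<ge> 0" using large n \<mu> by (auto simp: \<mu>_def n_def)
  have "card G * (card G - 2 * card V) * (card H * (card H - 2 * card V)) \<le> 4096 * card (gainful G V) * card V ^ 4"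
    using card_gainful_ge[OF V(1) G] H_def by blast
  then have "real (card G * (card G - 2 * card V) * (card H * (card H - 2 * card V)))
      \<le> real (4096 * card (gainful G V) * card V ^ 4)" by (simp only: of_nat_le_iff)
  moreover have "card G \<ge> 2 * card V" "card H \<ge> 2 * card V"
    using ge n by (simp_all add: a_def b_def n_def)
  ultimately have main: "a * (a - 2 * n) * (b * (b - 2 * n)) \<le> 4096 * real (card (gainful G V)) * n ^ 4"
    by (simp add: a_def b_def n_def of_nat_diff)
  have half: "a * (a / 2) \<le> a * (a - 2 * n)" "b * (b / 2) \<le> b * (b - 2 * n)"
    using ge n by (auto intro!: mult_left_mono)
  have "a * (a / 2) * (b * (b / 2)) \<le> a * (a - 2 * n) * (b * (b - 2 * n))"
    using half ge n by (intro mult_mono) auto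
  then have 1: "(a * b)\<^sup>2 \<le> 2 ^ 14 * real (card (gainful G V)) * n ^ 4"
    using main by (simp add: power2_eq_square algebra_simps)
  \<comment> \<open>The larger class has at least half of all pairs, and n(n - 1)/2 \<ge> n^2/4 for
    n \<ge> 2. Squaring the 8 gives the factor 2^6 that turns 2^14 into 2^20.\<close>
  have "max a b \<ge> n\<^sup>2 / 8"
  proof -
    have "n * 2 \<le> n * n" using n by (intro mult_left_mono) auto
    then have "n\<^sup>2 / 4 \<le> a + b" using sum by (simp add: power2_eq_square algebra_simps)
    then show ?thesis by (auto simp: max_def)
  qed
  then have "\<mu> * (n\<^sup>2 / 8) \<le> min a b * max a b" using ge \<mu> by (intro mult_mono) auto
  also have "\<dots> = a * b" by (auto simp: min_def max_def)
  finally have "(\<mu> * (n\<^sup>2 / 8))\<^sup>2 \<le> (a * b)\<^sup>2" using ge n by (intro power_mono) auto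
  then have "\<mu>\<^sup>2 * n ^ 4 \<le> 64 * (2 ^ 14 * real (card (gainful G V)) * n ^ 4)"
    using 1 by (simp add: power_mult_distrib power_divide)
  then have "\<mu>\<^sup>2 * n ^ 4 \<le> (2 ^ 20 * real (card (gainful G V))) * n ^ 4" by simp
  then show ?thesis using n unfolding \<mu>_def by (simp only: mult_le_cancel_right_pos zero_less_power)
qed

section \<open>The bound for placements of a tree on its own vertex set\<close>

lemma tree_embedding:
  fixes T :: "'a sgraph" and G :: "'a set set"
  assumes T: "tree T" and G: "G \<subseteq> [verts T]\<^bsup>2\<^esup>" and n: "n = card (verts T)" and m: "m = card G"
  shows "\<exists>p. p permutes verts T \<and> real_of_int (hits (edges T) G p) \<ge>
    2 * real m / real n + 1 / 2 ^ 25 * (real n - 1 - real (max_degree T)) * (m_star n m / (real n)\<^sup>2)\<^sup>2"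
proof -
  define V E where "V = verts T" and "E = edges T"
  have GV: "G \<subseteq> [V]\<^bsup>2\<^esup>" using G by (simp add: V_def)
  have V: "finite V" and E: "E \<subseteq> [V]\<^bsup>2\<^esup>" and Vne: "V \<noteq> {}"
    using T by (auto simp: tree_def simple_graph_def connected_graph_def V_def E_def)
  have cE: "card E + 1 = card V" using tree_card_edges[OF T] by (simp add: V_def E_def)
  have fN: "finite ([V]\<^bsup>2\<^esup>)" using V by (rule finite_imp_finite_nsets)
  have n': "n = card V" "n \<ge> 1" using n V Vne by (simp_all add: V_def Suc_leI card_gt_0_iff)
  \<comment> \<open>A best placement is fixed first, so that both the averaging bound and
    integrality speak about the same integer \<open>M\<close>.\<close>
  obtain p0 where p0: "p0 permutes V" and max: "\<And>p. p permutes V \<Longrightarrow> hits E G p \<le> hits E G p0"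
  proof -
    let ?X = "hits E G ` {p. p permutes V}"
    have fin: "finite ?X" using finite_permutations[OF V] by simp
    have ne: "?X \<noteq> {}" using permutes_id by blast
    obtain p0 where "p0 permutes V" "Max ?X = hits E G p0" using Max_in[OF fin ne] by auto
    then show ?thesis using that Max_ge[OF fin] by (metis imageI mem_Collect_eq)
  qed
  define M where "M = hits E G p0"
  have m_le: "m \<le> n choose 2" using card_mono[OF fN GV] card_pairs[OF V] m n'(1) by simp
  define \<mu> where "\<mu> = m_star n m"
  have \<mu>0: "\<mu> \<ge> 0" using m_le by (simp add: \<mu>_def m_star_def)
  have "real_of_int M \<ge> 2 * real m / real n + 1 / 2 ^ 25 * (real n - 1 - real (max_degree T)) * (\<mu> / (real n)\<^sup>2)\<^sup>2"
  proof (cases "n = 1")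
    case True
    then have "m = 0" "\<mu> = 0" using m_le by (simp_all add: \<mu>_def m_star_def choose_two)
    moreover have "M \<ge> 0" unfolding M_def hits_def by (intro sum_nonneg) simp
    ultimately show ?thesis by simp
  next
    case False
    then have n2: "card V \<ge> 2" using n' by simp
    obtain Q where Q: "\<forall>s\<in>Q. switch E s" "Q \<subseteq> quads V" "noninterfering Q"
      and cQ: "n \<le> 1 + max_degree T + 24 * card Q"
      using tree_switches[OF T] n by (auto simp: V_def E_def)
    have bound: "2 * real m / real n + real (card Q) * real (card (gainful G V)) / real n ^ 4 \<le> real_of_int M"
      using max_hits_ge[OF V n2 E cE GV Q, of M] max m n'(1) by (simp add: M_def)
    define k where "k = real n - 1 - real (max_degree T)"
    have kQ: "k \<le> 24 * real (card Q)" using cQ unfolding k_def by linarith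
    have npos: "real n > 0" using n' by simp
    have low: "2 * real m / real n \<le> real_of_int M"
    proof -
      have "0 \<le> real (card Q) * real (card (gainful G V)) / real n ^ 4" by simp
      then show ?thesis using bound by linarith
    qed
    consider "k \<le> 0 \<or> \<mu> = 0" | "k > 0" "\<mu> \<ge> 4 * real n" | "k > 0" "\<mu> \<noteq> 0" "\<mu> < 4 * real n" by linarith
    then have "2 * real m / real n + 1 / 2 ^ 25 * k * (\<mu> / (real n)\<^sup>2)\<^sup>2 \<le> real_of_int M"
    proof cases
      case 1
      then have "1 / 2 ^ 25 * k * (\<mu> / (real n)\<^sup>2)\<^sup>2 \<le> 0"
        by (elim disjE) (auto intro: mult_nonpos_nonneg)
      then show ?thesis using low by linarith
    next
      case 2
      have sq: "\<mu>\<^sup>2 \<le> 2 ^ 20 * real (card (gainful G V))"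
        using card_gainful_ge_square[OF V n2 GV] 2 m n'(1) by (simp add: \<mu>_def)
      \<comment> \<open>This fixes the constant: 24 * 2^20 is at most 2^25.\<close>
      have "1 / 2 ^ 25 * k * \<mu>\<^sup>2 \<le> 1 / 2 ^ 25 * (24 * real (card Q)) * (2 ^ 20 * real (card (gainful G V)))"
        using kQ sq 2 by (intro mult_mono) auto
      also have "\<dots> \<le> real (card Q) * real (card (gainful G V))" by simp
      finally have "1 / 2 ^ 25 * k * \<mu>\<^sup>2 / real n ^ 4 \<le> real (card Q) * real (card (gainful G V)) / real n ^ 4"
        by (rule divide_right_mono) simp
      moreover have "1 / 2 ^ 25 * k * \<mu>\<^sup>2 / real n ^ 4 = 1 / 2 ^ 25 * k * (\<mu> / (real n)\<^sup>2)\<^sup>2"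
        by (simp add: power_divide)
      ultimately show ?thesis using bound by linarith
    next
      case 3
      have Qpos: "card Q > 0" using kQ 3(1) by (cases "card Q = 0") auto
      then have "Q \<noteq> {}" by auto
      then have n4: "card V \<ge> 4" using quads_card_ge[OF V] Q(2) by blast
      \<comment> \<open>Without gainful quadruples the mean 2m/n is not an integer; with one of
        them, the averaging bound strictly exceeds the mean because \<open>Q\<close> is
        nonempty.\<close>
      have "real_of_int M \<noteq> 2 * real m / real n"
      proof (cases "gainful G V = {}")
        case True
        have "G \<noteq> {}" using 3(2) m by (auto simp: \<mu>_def m_star_def)
        moreover have "G \<noteq> [V]\<^bsup>2\<^esup>"
        proof
          assume "G = [V]\<^bsup>2\<^esup>"
          then show False using 3(2) m card_pairs[OF V] n'(1) by (simp add: \<mu>_def m_star_def)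
        qed
        ultimately have nd: "\<not> int n dvd 2 * int m"
          using not_dvd_if_gainful_empty[OF V n4 GV] True m n'(1) by simp
        show ?thesis
        proof
          assume "real_of_int M = 2 * real m / real n"
          then have "real_of_int (int n * M) = real_of_int (2 * int m)" using npos by (simp add: field_simps)
          then have "int n * M = 2 * int m" by (simp only: of_int_eq_iff)
          then show False using nd by (metis dvd_triv_left)
        qed
      next
        case False
        have "finite (gainful G V)" using finite_quads[OF V] by (simp add: gainful_def)
        then have "card (gainful G V) > 0" using False by (simp add: card_gt_0_iff)
        then have "real (card Q) * real (card (gainful G V)) / real n ^ 4 > 0" using Qpos npos by simp
        then show ?thesis using bound by linarith
      qed
      then have "2 * real m / real n < real_of_int M" using low by linarith
      then have "real_of_int (2 * int m) < real_of_int (int n * M)" using npos by (simp add: field_simps)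
      \<comment> \<open>Strict inequality between integers yields a surplus of 1, that is, a gain of
        1/n over the mean.\<close>
      then have "2 * int m + 1 \<le> int n * M" by (simp only: of_int_less_iff)
      then have "real_of_int (2 * int m + 1) \<le> real_of_int (int n * M)" by (simp only: of_int_le_iff)
      then have gain: "2 * real m / real n + 1 / real n \<le> real_of_int M" using npos by (simp add: field_simps)
      \<comment> \<open>With \<open>\<mu>\<close> below 4n and \<open>k\<close> at most n, the
        claimed gain is at most (16 / 2^25) / n, hence below the 1/n just obtained.\<close>
      have "\<mu>\<^sup>2 \<le> (4 * real n)\<^sup>2" using 3 \<mu>0 by (intro power_mono) auto
      moreover have "k \<le> real n" by (simp add: k_def)
      ultimately have "1 / 2 ^ 25 * k * \<mu>\<^sup>2 \<le> 1 / 2 ^ 25 * real n * (4 * real n)\<^sup>2"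
        using 3 by (intro mult_mono) auto
      also have "\<dots> \<le> real n ^ 3" by (simp add: power2_eq_square eval_nat_numeral)
      finally have "1 / 2 ^ 25 * k * \<mu>\<^sup>2 / real n ^ 4 \<le> real n ^ 3 / real n ^ 4"
        by (rule divide_right_mono) simp
      moreover have "real n ^ 3 / real n ^ 4 = 1 / real n" using npos by (simp add: eval_nat_numeral)
      moreover have "1 / 2 ^ 25 * k * \<mu>\<^sup>2 / real n ^ 4 = 1 / 2 ^ 25 * k * (\<mu> / (real n)\<^sup>2)\<^sup>2"
        by (simp add: power_divide)
      ultimately show ?thesis using gain by linarith
    qed
    then show ?thesis by (simp add: k_def)
  qed
  then show ?thesis using p0 unfolding M_def \<mu>_def V_def E_def by blast
qed

theorem theorem1p2:
  shows "\<exists>C::real. C > 0 \<and>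
    (\<forall>(r::nat) (n::nat) (c :: nat set \<Rightarrow> nat).
       r \<ge> 2 \<longrightarrow> edge_colouring r (complete_graph n) c \<longrightarrow>
       (\<forall>i\<in>{1..r}. \<forall>(T :: nat sgraph) (\<Delta>::nat).
          tree T \<longrightarrow> card (verts T) = n \<longrightarrow> max_degree T = \<Delta> \<longrightarrow>
          (let m = colour_count c i (complete_graph n) in
           \<exists>H. copy_in T (complete_graph n) H \<and>
             real (colour_count c i H) \<ge>
               2 * real m / real n
               + C * (real n - 1 - real \<Delta>) * (m_star n m / (real n)\<^sup>2)\<^sup>2)))"
proof (rule exI[of _ "1 / 2 ^ 25"], intro conjI allI impI ballI)
  show "(1 / 2 ^ 25 :: real) > 0" by simp
next
  fix r n i \<Delta> :: nat and c :: "nat set \<Rightarrow> nat" and T :: "nat sgraph"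
  assume T: "tree T" and n: "card (verts T) = n" and \<Delta>: "max_degree T = \<Delta>"
  define V E where "V = verts T" and "E = edges T"
  have V: "finite V" and E: "E \<subseteq> [V]\<^bsup>2\<^esup>"
    using T by (auto simp: tree_def simple_graph_def V_def E_def)
  \<comment> \<open>The colour class is pulled back along \<open>b\<close> to the vertices of
    \<open>T\<close>, where placements are permutations; composing with \<open>b\<close> then
    carries the placement found to the complete graph.\<close>
  obtain b where b: "bij_betw b V {1..n}"
    using finite_same_card_bij[OF V, of "{1..n}"] n by (auto simp: V_def)
  define G where "G = {e \<in> [V]\<^bsup>2\<^esup>. c (b ` e) = i}"
  have GV: "G \<subseteq> [V]\<^bsup>2\<^esup>" by (auto simp: G_def)
  have m: "colour_count c i (complete_graph n) = card G"
  proof -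
    have bb: "bij_betw (\<lambda>e. b ` e) ([V]\<^bsup>2\<^esup>) ([{1..n}]\<^bsup>2\<^esup>)" using b by (rule bij_betw_nsets)
    then have "[{1..n}]\<^bsup>2\<^esup> = (\<lambda>e. b ` e) ` ([V]\<^bsup>2\<^esup>)" by (simp only: bij_betw_def)
    then have "{e \<in> [{1..n}]\<^bsup>2\<^esup>. c e = i} = (\<lambda>e. b ` e) ` G"
      by (simp only: G_def Compr_image_eq)
    moreover have "inj_on (\<lambda>e. b ` e) G" using bb GV by (meson bij_betw_def inj_on_subset)
    ultimately show ?thesis by (simp add: colour_count_def complete_graph_def card_image)
  qed
  obtain p where p: "p permutes V" and ge: "real_of_int (hits E G p) \<ge>
      2 * real (card G) / real n + 1 / 2 ^ 25 * (real n - 1 - real \<Delta>) * (m_star n (card G) / (real n)\<^sup>2)\<^sup>2"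
    using tree_embedding[OF T GV[unfolded V_def] n [symmetric] refl] \<Delta> by (auto simp: V_def E_def)
  define f where "f = b \<circ> p"
  have f: "bij_betw f V {1..n}" unfolding f_def using permutes_imp_bij[OF p] b by (rule bij_betw_trans)
  have ff: "bij_betw (\<lambda>e. f ` e) ([V]\<^bsup>2\<^esup>) ([{1..n}]\<^bsup>2\<^esup>)" using f by (rule bij_betw_nsets)
  define H where "H = \<lparr>verts = {1..n}, edges = (\<lambda>e. f ` e) ` E\<rparr>"
  have injE: "inj_on (\<lambda>e. f ` e) E" using ff E by (meson bij_betw_def inj_on_subset)
  have eH: "edges H \<subseteq> [{1..n}]\<^bsup>2\<^esup>" using ff E by (auto simp: H_def bij_betw_def)
  have "copy_in T (complete_graph n) H"
    unfolding copy_in_def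
  proof
    show "subgraph H (complete_graph n)"
      using eH by (simp add: subgraph_def simple_graph_def complete_graph_def H_def)
    have "{u, v} \<in> E \<longleftrightarrow> {f u, f v} \<in> (\<lambda>e. f ` e) ` E" if uv: "u \<in> V" "v \<in> V" for u v
    proof
      assume "{f u, f v} \<in> (\<lambda>e. f ` e) ` E"
      then obtain e where e: "e \<in> E" "f ` {u, v} = f ` e" by auto
      then have "e \<subseteq> V" using E by (auto simp: nsets_def)
      then have "{u, v} = e"
        using inj_on_image_eq_iff[of f V "{u, v}" e] f e uv by (simp add: bij_betw_def)
      then show "{u, v} \<in> E" using e by simp
    qed (use image_iff in fastforce)
    then show "isomorphic T H"
      unfolding isomorphic_def using f by (auto simp: H_def V_def E_def intro!: exI[of _ f])
  qed
  moreover have "int (colour_count c i H) = hits E G p"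
  proof -
    have "{e \<in> edges H. c e = i} = (\<lambda>e. f ` e) ` {e \<in> E. p ` e \<in> G}"
    proof -
      have "c (f ` e) = i \<longleftrightarrow> p ` e \<in> G" if "e \<in> E" for e
      proof -
        have "p ` e \<in> [V]\<^bsup>2\<^esup>"
          using that E bij_betw_nsets[OF permutes_imp_bij[OF p], of 2] by (auto simp: bij_betw_def)
        then show ?thesis by (simp add: G_def f_def image_comp)
      qed
      then show ?thesis by (auto simp: H_def)
    qed
    then have "colour_count c i H = card {e \<in> E. p ` e \<in> G}"
      using inj_on_subset[OF injE, of "{e \<in> E. p ` e \<in> G}"] by (simp add: colour_count_def card_image)
    then show ?thesis using finite_edges[OF V E] by (simp add: hits_def Int_def)
  qed
  ultimately show "let m = colour_count c i (complete_graph n) in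
      \<exists>H. copy_in T (complete_graph n) H \<and> real (colour_count c i H) \<ge> 2 * real m / real n
        + 1 / 2 ^ 25 * (real n - 1 - real \<Delta>) * (m_star n m / (real n)\<^sup>2)\<^sup>2"
    unfolding Let_def m using ge by (metis of_int_of_nat_eq)
qed

end
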